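(* Let $(X,\mu,m)$ be a connected weighted graph such that every bounded harmonic function on $X$ is constant. Then every harmonic map of finite energy from the graph into a locally compact Hadamard space is constant.
   Context: Weighted graph: $X$ is a countable discrete set, $m:X\to(0,\infty)$ is extended additively to a measure on all subsets of $X$, and $\mu:X\times X\to[0,\infty)$, $(x,y)\mapsto\mu_{xy}$, is symmetric, zero on the diagonal, and satisfies $\sum_{y\in X}\mu_{xy}<\infty$ for all $x\in X$ (local finiteness is not assumed). Write $x\sim y$ if $\mu_{xy}>0$. The graph is connected if any two vertices $x,y$ are joined by a path $x=x_0\sim x_1\sim\dots\sim x_n=y$. Harmonic functions: let $F(X)=\{f:X\to\mathbb{R}\mid \sum_{y\in X}\mu_{xy}|f(y)|<\infty \text{ for all }x\in X\}$ and $\Delta f(x)=\frac1{m(x)}\sum_{y\in X}\mu_{xy}(f(x)-f(y))$ for $f\in F(X)$. A function $f:X\to\mathbb{R}$ is harmonic if $f\in F(X)$ and $\Delta f=0$. Harmonic maps: an Hadamard space $(Y,d)$ is a complete geodesic $\mathrm{CAT}(0)$ space; it is locally compact if every point has a precompact neighborhood. Let $P^1(Y)$ be the probability measures on $Y$ with finite first moment. For $\nu\in P^1(Y)$ the barycenter $b(\nu)\in Y$ is the unique minimizer of $z\mapsto\int_Y\big(d^2(z,y)-d^2(w,y)\big)\nu(dy)$, which does not depend on the choice of $w\in Y$. Put $P_x(y)=\mu_{xy}/\sum_{z\in X}\mu_{xz}$ and let $F(X,Y)$ be the set of maps $u:X\to Y$ with $\sum_{y\in X}d(u(y),y_0)P_x(y)<\infty$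 for all $x\in X$, $y_0\in Y$. A map $u:X\to Y$ is harmonic if $u\in F(X,Y)$ and $u(x)=b(u_*P_x)$ for every $x\in X$, where $u_*P_x$ is the push forward of $P_x$ under $u$. A harmonic map $u$ has finite energy if $\frac12\sum_{x,y\in X}\mu_{xy}d^2(u(x),u(y))<\infty$. *)

theory Defs
  imports "HOL-Probability.Probability"
begin

section \<open>Weighted graphs and harmonic functions\<close>

locale weighted_graph =
  fixes m :: "'x::countable \<Rightarrow> real" and \<mu> :: "'x \<Rightarrow> 'x \<Rightarrow> real"
  assumes vertex_weight_pos: "m x > 0"
    and edge_weight_nonneg: "\<mu> x y \<ge> 0"
    and edge_weight_sym: "\<mu> x y = \<mu> y x"
    and edge_weight_diag: "\<mu> x x = 0"
    and edge_weight_summable: "(\<lambda>y. \<mu> x y) summable_on UNIV"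

definition connected_graph :: "('x \<Rightarrow> 'x \<Rightarrow> real) \<Rightarrow> bool" where
  "connected_graph \<mu> \<longleftrightarrow> (\<forall>x y. (\<lambda>a b. \<mu> a b > 0)\<^sup>*\<^sup>* x y)"

definition laplacian_domain :: "('x \<Rightarrow> 'x \<Rightarrow> real) \<Rightarrow> ('x \<Rightarrow> real) set" where
  "laplacian_domain \<mu> = {f. \<forall>x. (\<lambda>y. \<mu> x y * \<bar>f y\<bar>) summable_on UNIV}"

definition laplacian ::
    "('x \<Rightarrow> real) \<Rightarrow> ('x \<Rightarrow> 'x \<Rightarrow> real) \<Rightarrow> ('x \<Rightarrow> real) \<Rightarrow> 'x \<Rightarrow> real" where
  "laplacian m \<mu> f x = 1 / m x * (\<Sum>\<^sub>\<infinity>y. \<mu> x y * (f x - f y))"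

definition harmonic_function ::
    "('x \<Rightarrow> real) \<Rightarrow> ('x \<Rightarrow> 'x \<Rightarrow> real) \<Rightarrow> ('x \<Rightarrow> real) \<Rightarrow> bool" where
  "harmonic_function m \<mu> f \<longleftrightarrow> f \<in> laplacian_domain \<mu> \<and> (\<forall>x. laplacian m \<mu> f x = 0)"


section \<open>Hadamard spaces\<close>

text \<open>A geodesic from \<open>a\<close> to \<open>b\<close> is parametrized by arc length; its values outside
  \<open>{0..dist a b}\<close> are irrelevant.\<close>

definition geodesic :: "'y::metric_space \<Rightarrow> 'y \<Rightarrow> (real \<Rightarrow> 'y) \<Rightarrow> bool" where
  "geodesic a b c \<longleftrightarrow> c 0 = a \<and> c (dist a b) = b \<and>
     (\<forall>s\<in>{0..dist a b}. \<forall>t\<in>{0..dist a b}. dist (c s) (c t) = \<bar>s - t\<bar>)"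

text \<open>In the CAT(0) axiom, \<open>p' q' r'\<close> is a comparison triangle in the Euclidean plane and
  \<open>x'\<close>, \<open>y'\<close> are the comparison points of \<open>c s\<close> and \<open>c' t\<close>. It is enough to speak of the two
  sides issuing from \<open>p\<close>: any two different sides of a triangle share a vertex, the vertices
  are arbitrary, and points on the same side always satisfy the inequality.\<close>

class hadamard_space = complete_space +
  assumes geodesic_exists: "\<exists>c. geodesic a b c"
    and CAT0: "geodesic p q c \<Longrightarrow> geodesic p r c' \<Longrightarrow>
      dist p' q' = dist p q \<Longrightarrow> dist q' r' = dist q r \<Longrightarrow> dist p' r' = dist p r \<Longrightarrow>
      s \<in> {0..dist p q} \<Longrightarrow> t \<in> {0..dist p r} \<Longrightarrow>
      x' \<in> closed_segment p' q' \<Longrightarrow> dist p' x' = s \<Longrightarrow>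
      y' \<in> closed_segment p' r' \<Longrightarrow> dist p' y' = t \<Longrightarrow>
      dist (c s) (c' t) \<le> dist x' (y' :: real ^ 2)"


section \<open>Barycenters and harmonic maps\<close>

definition prob_first_moment :: "'y::metric_space measure set" where
  "prob_first_moment =
     {\<nu>. sets \<nu> = sets borel \<and> prob_space \<nu> \<and> (\<forall>z. integrable \<nu> (\<lambda>y. dist z y))}"

text \<open>Strictness expresses that \<open>b\<close> is the unique minimizer. On Hadamard spaces every
  \<open>\<nu> \<in> prob_first_moment\<close> has exactly one barycenter, and changing \<open>w\<close> only adds a constant
  to the functional.\<close>

definition is_barycenter :: "'y::metric_space measure \<Rightarrow> 'y \<Rightarrow> bool" where
  "is_barycenter \<nu> b \<longleftrightarrow> \<nu> \<in> prob_first_moment \<and>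
     (\<forall>w z. z \<noteq> b \<longrightarrow>
       (\<integral>y. (dist b y)\<^sup>2 - (dist w y)\<^sup>2 \<partial>\<nu>) < (\<integral>y. (dist z y)\<^sup>2 - (dist w y)\<^sup>2 \<partial>\<nu>))"

definition transition_prob :: "('x \<Rightarrow> 'x \<Rightarrow> real) \<Rightarrow> 'x \<Rightarrow> 'x \<Rightarrow> real" where
  "transition_prob \<mu> x y = \<mu> x y / (\<Sum>\<^sub>\<infinity>z. \<mu> x z)"

definition transition_measure :: "('x \<Rightarrow> 'x \<Rightarrow> real) \<Rightarrow> 'x \<Rightarrow> 'x measure" where
  "transition_measure \<mu> x = point_measure UNIV (\<lambda>y. ennreal (transition_prob \<mu> x y))"

definition map_domain :: "('x \<Rightarrow> 'x \<Rightarrow> real) \<Rightarrow> ('x \<Rightarrow> 'y::metric_space) set" where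
  "map_domain \<mu> =
     {u. \<forall>x y0. (\<lambda>y. dist (u y) y0 * transition_prob \<mu> x y) summable_on UNIV}"

definition harmonic_map :: "('x \<Rightarrow> 'x \<Rightarrow> real) \<Rightarrow> ('x \<Rightarrow> 'y::metric_space) \<Rightarrow> bool" where
  "harmonic_map \<mu> u \<longleftrightarrow> u \<in> map_domain \<mu> \<and>
     (\<forall>x. is_barycenter (distr (transition_measure \<mu> x) borel u) (u x))"

definition energy :: "('x \<Rightarrow> 'x \<Rightarrow> real) \<Rightarrow> ('x \<Rightarrow> 'y::metric_space) \<Rightarrow> ennreal" where
  "energy \<mu> u = 1 / 2 * (\<Sum>\<^sub>\<infinity>(x, y). ennreal (\<mu> x y * (dist (u x) (u y))\<^sup>2))"

end

theory Submission
  imports Defs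
begin

text \<open>
  Fix \<open>p\<close> in the target and put \<open>f\<^sub>p x = dist (u x) p\<close>. In a CAT(0) space a barycenter is at most as
  far from \<open>p\<close> as its measure is on average (\<open>barycenter_dist_le_mean\<close>), so every \<open>f\<^sub>p\<close> is
  subharmonic; finite energy of \<open>u\<close> gives \<open>f\<^sub>p\<close> finite Dirichlet energy. The theorem follows from two
  consequences of the Liouville property for real-valued functions.

  \<^item> A nonnegative subharmonic function \<open>f\<close> of finite energy is bounded
    (\<open>finite_energy_subharmonic_bounded\<close>). Let \<open>D\<^sub>0\<close> be the closure of the finitely supported functions
    in the energy norm. Minimizing the energy of \<open>g - \<psi>\<close> over finitely supported \<open>\<psi>\<close> produces a
    harmonic function with the same bounds as \<open>g\<close>; so a bounded \<open>g\<close> of finite energy lies in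
    \<open>c + D\<^sub>0\<close> for a constant \<open>c\<close> (\<open>approximable_up_to_constant\<close>). On the other hand, testing
    subharmonicity of \<open>f\<close> against the positive part of an element \<open>min f N - w\<close> of \<open>D\<^sub>0\<close>
    shows that this positive part becomes constant as the energy of \<open>w\<close> tends to zero
    (\<open>truncation_constant\<close>). If \<open>f\<close> is unbounded, then the first fact, combined with the second for
    constant \<open>w\<close>, puts \<open>min f N - N\<close> in \<open>D\<^sub>0\<close> for all large \<open>N\<close>; so
    \<open>min f N - (N / M) min f M\<close> is in \<open>D\<^sub>0\<close> as well, and the second fact with \<open>M\<close> tending to
    infinity makes \<open>min f N\<close> constant, which is absurd.

  \<^item> If \<open>P\<close> is the averaging operator of the random walk and \<open>f\<close> is bounded and subharmonic, then
    \<open>P\<^sup>n f\<close> increases to a bounded harmonic function, that is to a constant, which can only be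
    the supremum of \<open>f\<close> (\<open>iterated_average_tendsto_Sup\<close>). By linearity of \<open>P\<close> the supremum of a finite
    sum of such functions is the sum of the suprema, so finitely many bounded subharmonic functions
    come close to their suprema at one common vertex
    (\<open>subharmonic_simultaneously_near_Sup\<close>).

  The first consequence puts the image of \<open>u\<close> into a closed ball, which is compact because the target
  is a locally compact complete geodesic space (\<open>compact_cball_locally_compact_hadamard\<close>). Cover this ball
  by finitely many balls of radius \<open>\<epsilon>\<close> with centers \<open>p\<^sub>i\<close>, and take a vertex \<open>x\<close> at which all the
  distances \<open>dist (u x) p\<^sub>i\<close> are within \<open>\<epsilon>\<close> of their suprema. Some \<open>p\<^sub>i\<close> is within \<open>\<epsilon>\<close> of \<open>u x\<close>,
  so the whole image is within \<open>2 \<epsilon>\<close> of this \<open>p\<^sub>i\<close>. Hence the image of \<open>u\<close> has diameter zero.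
\<close>

section \<open>Barycenters in Hadamard spaces\<close>

lemma dist_vector_2: "dist (vector [a, b]) (vector [c, d] :: real ^ 2) = sqrt ((a - c)\<^sup>2 + (b - d)\<^sup>2)"
  by (simp add: dist_vec_def L2_set_def sum_2 dist_real_def)

lemma comparison_triangle_exists:
  fixes a b c :: real
  assumes "0 < a" "0 \<le> b" "0 \<le> c" "a \<le> b + c" "b \<le> a + c" "c \<le> a + b"
  obtains x y where "x\<^sup>2 + y\<^sup>2 = b\<^sup>2" "(a - x)\<^sup>2 + y\<^sup>2 = c\<^sup>2"
proof -
  define x where "x = (a\<^sup>2 + b\<^sup>2 - c\<^sup>2) / (2 * a)"
  have x: "2 * a * x = a\<^sup>2 + b\<^sup>2 - c\<^sup>2"
    using assms by (simp add: x_def)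
  \<comment> \<open>Heron's formula: the product is nonnegative by the triangle inequalities.\<close>
  have "0 \<le> ((b + c - a) * (a + c - b)) * ((a + b - c) * (a + b + c))"
    using assms by (intro mult_nonneg_nonneg) auto
  also have "\<dots> = 4 * a\<^sup>2 * b\<^sup>2 - (2 * a * x)\<^sup>2"
    unfolding x by algebra
  also have "\<dots> = 4 * a\<^sup>2 * (b\<^sup>2 - x\<^sup>2)"
    by algebra
  finally have "0 \<le> b\<^sup>2 - x\<^sup>2"
    using \<open>0 < a\<close> by (simp add: zero_le_mult_iff)
  then obtain y where y: "y\<^sup>2 = b\<^sup>2 - x\<^sup>2"
    by (metis real_sqrt_pow2)
  have "(a - x)\<^sup>2 + y\<^sup>2 = a\<^sup>2 - 2 * a * x + b\<^sup>2"
    using y by algebra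
  then show ?thesis
    using that[of x y] x y by simp
qed

text \<open>Stewart's identity in the comparison triangle; the second side in the CAT(0) axiom is a
  geodesic from \<open>b\<close> to \<open>z\<close>, evaluated at its end point.\<close>

lemma CAT0_quadratic_inequality:
  fixes b p z :: "'y::hadamard_space"
  assumes c: "geodesic b p c" and "b \<noteq> p" and t: "0 \<le> t" "t \<le> 1"
  shows "(dist (c (t * dist b p)) z)\<^sup>2
    \<le> (1 - t) * (dist b z)\<^sup>2 + t * (dist p z)\<^sup>2 - t * (1 - t) * (dist b p)\<^sup>2"
proof -
  define L where "L = dist b p"
  have L: "0 < L" using \<open>b \<noteq> p\<close> by (simp add: L_def)
  obtain x y where xy: "x\<^sup>2 + y\<^sup>2 = (dist b z)\<^sup>2" "(L - x)\<^sup>2 + y\<^sup>2 = (dist p z)\<^sup>2"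
  proof (rule comparison_triangle_exists[of L "dist b z" "dist p z"])
    show "L \<le> dist b z + dist p z" "dist b z \<le> L + dist p z" "dist p z \<le> L + dist b z"
      unfolding L_def by (metis dist_commute dist_triangle)+
  qed (use L in auto)
  obtain c' where c': "geodesic b z c'" using geodesic_exists by blast
  let ?p = "vector [0, 0] :: real ^ 2" and ?q = "vector [L, 0] :: real ^ 2"
    and ?r = "vector [x, y] :: real ^ 2" and ?x = "vector [t * L, 0] :: real ^ 2"
  have "dist (c (t * L)) (c' (dist b z)) \<le> dist ?x ?r"
  proof (rule CAT0[OF c c'])
    show "dist ?p ?q = dist b p" "dist ?p ?x = t * L"
      using L t by (simp_all add: dist_vector_2 L_def)
    show "dist ?q ?r = dist p z" "dist ?p ?r = dist b z" "dist ?p ?r = dist b z"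
      using xy by (simp_all add: dist_vector_2)
    show "t * L \<in> {0..dist b p}"
      using L t by (auto simp: L_def mult_left_le_one_le)
    have "?x = (1 - t) *\<^sub>R ?p + t *\<^sub>R ?q"
      by (simp add: vec_eq_iff forall_2)
    then show "?x \<in> closed_segment ?p ?q"
      using t by (auto simp: in_segment)
  qed auto
  moreover have "c' (dist b z) = z" using c' by (simp add: geodesic_def)
  ultimately have "dist (c (t * L)) z \<le> sqrt ((t * L - x)\<^sup>2 + y\<^sup>2)"
    by (simp add: dist_vector_2)
  then have "(dist (c (t * L)) z)\<^sup>2 \<le> (t * L - x)\<^sup>2 + y\<^sup>2"
    by (metis power_mono real_sqrt_pow2 sum_power2_ge_zero zero_le_dist)
  also have "\<dots> = (1 - t) * (x\<^sup>2 + y\<^sup>2) + t * ((L - x)\<^sup>2 + y\<^sup>2) - t * (1 - t) * L\<^sup>2"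
    by algebra
  finally show ?thesis unfolding xy by (simp add: L_def)
qed

lemma abs_diff_dist_squared_le:
  "\<bar>(dist a y)\<^sup>2 - (dist b y)\<^sup>2\<bar> \<le> dist a b * (dist a y + dist b y)"
proof -
  have "\<bar>(dist a y)\<^sup>2 - (dist b y)\<^sup>2\<bar> = \<bar>dist a y - dist b y\<bar> * (dist a y + dist b y)"
    by (simp add: power2_eq_square square_diff_square_factored abs_mult)
  also have "\<dots> \<le> dist a b * (dist a y + dist b y)"
    using abs_dist_diff_le[of a y b] by (intro mult_right_mono) (auto simp: dist_commute)
  finally show ?thesis .
qed

lemma integrable_diff_dist_squared:
  assumes "\<nu> \<in> prob_first_moment"
  shows "integrable \<nu> (\<lambda>y. (dist a y)\<^sup>2 - (dist b y)\<^sup>2)"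
proof (rule Bochner_Integration.integrable_bound)
  have sets: "sets \<nu> = sets borel" and int: "\<And>z. integrable \<nu> (dist z)"
    using assms by (auto simp: prob_first_moment_def)
  show "integrable \<nu> (\<lambda>y. dist a b * (dist a y + dist b y))"
    using int by (intro integrable_mult_right Bochner_Integration.integrable_add)
  have "(\<lambda>y. (dist a y)\<^sup>2 - (dist b y)\<^sup>2) \<in> borel_measurable borel"
    by (intro borel_measurable_continuous_onI continuous_intros)
  then show "(\<lambda>y. (dist a y)\<^sup>2 - (dist b y)\<^sup>2) \<in> borel_measurable \<nu>"
    using measurable_cong_sets[OF sets refl] by blast
  show "AE y in \<nu>. norm ((dist a y)\<^sup>2 - (dist b y)\<^sup>2) \<le> norm (dist a b * (dist a y + dist b y))"
    using abs_diff_dist_squared_le[of a _ b] by (intro AE_I2) (simp add: abs_mult)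
qed

text \<open>Move the barycenter along the geodesic towards \<open>p\<close>: by minimality the functional does not
  decrease, and by the CAT(0) inequality its increase at time \<open>t\<close> is at most
  \<open>t (I - (1 - t) (dist b p)\<^sup>2)\<close>, where \<open>I\<close> is the right-hand side. Divide by \<open>t\<close> and let \<open>t\<close> tend
  to zero.\<close>

lemma barycenter_variance_inequality:
  fixes b p :: "'y::hadamard_space"
  assumes b: "is_barycenter \<nu> b"
  shows "(dist b p)\<^sup>2 \<le> (\<integral>y. (dist p y)\<^sup>2 - (dist b y)\<^sup>2 \<partial>\<nu>)"
proof (cases "b = p")
  case False
  have \<nu>: "\<nu> \<in> prob_first_moment" using b by (simp add: is_barycenter_def)
  then interpret prob_space \<nu> by (simp add: prob_first_moment_def)
  obtain c where c: "geodesic b p c" using geodesic_exists by blast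
  define L where "L = dist b p"
  define I where "I = (\<integral>y. (dist p y)\<^sup>2 - (dist b y)\<^sup>2 \<partial>\<nu>)"
  note [simp] = integrable_diff_dist_squared[OF \<nu>]
  have "(1 - t) * L\<^sup>2 \<le> I" if t: "0 < t" "t \<le> 1" for t
  proof -
    have "0 \<le> (\<integral>y. (dist (c (t * L)) y)\<^sup>2 - (dist b y)\<^sup>2 \<partial>\<nu>)"
    proof (cases "c (t * L) = b")
      case False
      then have "(\<integral>y. (dist b y)\<^sup>2 - (dist b y)\<^sup>2 \<partial>\<nu>)
          < (\<integral>y. (dist (c (t * L)) y)\<^sup>2 - (dist b y)\<^sup>2 \<partial>\<nu>)"
        using b unfolding is_barycenter_def by blast
      then show ?thesis by simp
    qed simp
    also have "\<dots> \<le> (\<integral>y. t * ((dist p y)\<^sup>2 - (dist b y)\<^sup>2) - t * (1 - t) * L\<^sup>2 \<partial>\<nu>)"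
    proof (intro integral_mono)
      fix y
      have "(dist (c (t * L)) y)\<^sup>2
        \<le> (1 - t) * (dist b y)\<^sup>2 + t * (dist p y)\<^sup>2 - t * (1 - t) * L\<^sup>2"
        using CAT0_quadratic_inequality[OF c False] t by (simp add: L_def)
      then show "(dist (c (t * L)) y)\<^sup>2 - (dist b y)\<^sup>2
        \<le> t * ((dist p y)\<^sup>2 - (dist b y)\<^sup>2) - t * (1 - t) * L\<^sup>2"
        by (simp add: algebra_simps)
    qed auto
    also have "\<dots> = t * (I - (1 - t) * L\<^sup>2)"
      unfolding I_def
      by (subst Bochner_Integration.integral_diff, intro integrable_mult_right integrable_diff_dist_squared[OF \<nu>], simp,
          subst integral_mult_right_zero, simp add: prob_space algebra_simps del: Bochner_Integration.integral_diff)
    finally show ?thesis using t by (simp add: zero_le_mult_iff)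
  qed
  then have "\<forall>\<^sub>F t in at_right 0. (1 - t) * L\<^sup>2 \<le> I"
    unfolding eventually_at_right_field by (intro exI[of _ 1]) auto
  moreover have "((\<lambda>t. (1 - t) * L\<^sup>2) \<longlongrightarrow> (1 - 0) * L\<^sup>2) (at_right 0)"
    by (intro tendsto_intros)
  ultimately have "(1 - 0) * L\<^sup>2 \<le> I"
    by (intro tendsto_upperbound) auto
  then show ?thesis by (simp add: I_def L_def)
qed simp

text \<open>Jensen's inequality for the convex function \<open>dist p\<close>. With \<open>L = dist b p\<close>, the triangle
  inequality \<open>\<bar>L - dist p y\<bar> \<le> dist b y\<close> turns the integrand of the variance inequality into
  at most \<open>2 L dist p y - L\<^sup>2\<close>, which is affine in \<open>dist p y\<close>. So
  \<open>L\<^sup>2 \<le> 2 L \<integral> dist p - L\<^sup>2\<close>.\<close>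

lemma barycenter_dist_le_mean:
  fixes b p :: "'y::hadamard_space"
  assumes b: "is_barycenter \<nu> b"
  shows "dist b p \<le> (\<integral>y. dist p y \<partial>\<nu>)"
proof (cases "b = p")
  case False
  have \<nu>: "\<nu> \<in> prob_first_moment" using b by (simp add: is_barycenter_def)
  then interpret prob_space \<nu> by (simp add: prob_first_moment_def)
  have int: "integrable \<nu> (dist p)" using \<nu> by (simp add: prob_first_moment_def)
  define L where "L = dist b p"
  have L: "0 < L" using False by (simp add: L_def)
  have "L\<^sup>2 \<le> (\<integral>y. (dist p y)\<^sup>2 - (dist b y)\<^sup>2 \<partial>\<nu>)"
    unfolding L_def by (rule barycenter_variance_inequality[OF b])
  also have "\<dots> \<le> (\<integral>y. 2 * L * dist p y - L\<^sup>2 \<partial>\<nu>)"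
  proof (intro integral_mono)
    fix y
    have "\<bar>L - dist p y\<bar> \<le> dist b y"
      using abs_dist_diff_le[of b p y] dist_triangle[of p y b]
      unfolding L_def by (smt (verit) dist_commute dist_triangle)
    then have "(L - dist p y)\<^sup>2 \<le> (dist b y)\<^sup>2"
      by (simp add: abs_le_square_iff[symmetric])
    then show "(dist p y)\<^sup>2 - (dist b y)\<^sup>2 \<le> 2 * L * dist p y - L\<^sup>2"
      by (simp add: power2_eq_square algebra_simps)
  qed (use int integrable_diff_dist_squared[OF \<nu>] in auto)
  also have "\<dots> = 2 * L * (\<integral>y. dist p y \<partial>\<nu>) - L\<^sup>2"
    using int by (subst Bochner_Integration.integral_diff) (auto simp: prob_space)
  finally have "2 * L * L \<le> 2 * L * (\<integral>y. dist p y \<partial>\<nu>)"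
    by (simp add: power2_eq_square)
  then show ?thesis using L by (simp add: L_def)
qed simp

section \<open>Properness of locally compact Hadamard spaces\<close>

lemma geodesic_point_dist:
  assumes c: "geodesic a b c" and s: "s \<in> {0..dist a b}"
  shows "dist a (c s) = s" "dist (c s) b = dist a b - s"
proof -
  have ends: "c 0 = a" "c (dist a b) = b"
    and geo: "\<And>s t. s \<in> {0..dist a b} \<Longrightarrow> t \<in> {0..dist a b} \<Longrightarrow> dist (c s) (c t) = \<bar>s - t\<bar>"
    using c unfolding geodesic_def by blast+
  show "dist a (c s) = s" "dist (c s) b = dist a b - s"
    using geo[of 0 s] geo[of s "dist a b"] s by (simp_all add: ends)
qed

text \<open>A point of the ball that is not within \<open>e\<close> of the center moves, by \<open>e / 2\<close> along a geodesic
  towards the center, into the compact ball of radius \<open>r - e / 2\<close>. So the ball is totally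
  bounded, and it is complete because it is closed.\<close>

lemma compact_cball_if_smaller:
  fixes p :: "'y::hadamard_space"
  assumes "\<And>s. s < r \<Longrightarrow> compact (cball p s)"
  shows "compact (cball p r)"
  unfolding compact_eq_totally_bounded
proof safe
  show "uniform_space_class.complete (cball p r)" by (simp add: complete_eq_closed)
  fix e :: real assume e: "e > 0"
  then have "compact (cball p (r - e / 2))" by (intro assms) simp
  then obtain k where k: "finite k" "cball p (r - e / 2) \<subseteq> (\<Union>x\<in>k. ball x (e / 2))"
    unfolding compact_eq_totally_bounded using e by (meson half_gt_zero)
  have "cball p r \<subseteq> (\<Union>x\<in>insert p k. ball x e)"
  proof
    fix y assume y: "y \<in> cball p r"
    obtain c where c: "geodesic p y c" using geodesic_exists by blast
    show "y \<in> (\<Union>x\<in>insert p k. ball x e)"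
    proof (cases "dist p y < e")
      case True then show ?thesis by simp
    next
      case False
      define s where "s = dist p y - e / 2"
      have s: "s \<in> {0..dist p y}" using False e by (simp add: s_def)
      then have ps: "dist p (c s) = s" and sy: "dist (c s) y = e / 2"
        using geodesic_point_dist[OF c s] by (simp_all add: s_def)
      then have "c s \<in> cball p (r - e / 2)" using y by (simp add: s_def)
      then obtain x where x: "x \<in> k" "dist x (c s) < e / 2" using k by auto
      then have "dist x y < e" using sy dist_triangle[of x y "c s"] by simp
      then show ?thesis using x by auto
    qed
  qed
  then show "\<exists>k. finite k \<and> cball p r \<subseteq> (\<Union>x\<in>k. ball x e)"
    using k by blast
qed

text \<open>Finitely many compact balls, already at half of their radii, cover \<open>cball p r\<close>; if \<open>d\<close> is at
  most all of these half radii, then the full balls cover the \<open>d\<close>-neighborhood of \<open>cball p r\<close>, which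
  contains \<open>cball p (r + d)\<close> as the space is geodesic.\<close>

lemma compact_cball_enlarge:
  fixes p :: "'y::hadamard_space"
  assumes lc: "locally_compact_space (euclidean :: 'y topology)"
    and r: "compact (cball p r)" "0 \<le> r"
  shows "\<exists>r'>r. compact (cball p r')"
proof -
  have "\<forall>x :: 'y. \<exists>e>0. compact (cball x e)"
  proof
    fix x :: 'y
    have "\<exists>U. open U \<and> (\<exists>K. compact K \<and> x \<in> U \<and> U \<subseteq> K)"
      using lc by (simp add: locally_compact_space_def)
    then obtain U K where UK: "open U" "compact K" "x \<in> U" "U \<subseteq> K" by blast
    then obtain e where e: "e > 0" "cball x e \<subseteq> U"
      by (meson open_contains_cball)
    then have "compact (K \<inter> cball x e)" using UK by (intro compact_Int_closed) auto
    moreover have "K \<inter> cball x e = cball x e" using e UK by blast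
    ultimately show "\<exists>e>0. compact (cball x e)" using e by auto
  qed
  then obtain e :: "'y \<Rightarrow> real" where e: "\<And>x. e x > 0" "\<And>x. compact (cball x (e x))" by metis
  obtain D where D: "finite D" "D \<subseteq> cball p r" "cball p r \<subseteq> (\<Union>x\<in>D. ball x (e x / 2))"
  proof (rule compactE_image[OF r(1), of "cball p r" "\<lambda>x. ball x (e x / 2)"])
    show "cball p r \<subseteq> (\<Union>x\<in>cball p r. ball x (e x / 2))"
      using e(1) by (auto intro!: UN_I)
  qed auto
  have "D \<noteq> {}" using D(3) r(2) by auto
  define d where "d = Min ((\<lambda>x. e x / 2) ` D)"
  have d: "d > 0"
    using D(1) \<open>D \<noteq> {}\<close> e(1) by (simp add: d_def)
  have d_le: "d \<le> e x / 2" if "x \<in> D" for x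
    unfolding d_def using D(1) that by (intro Min_le) auto
  have "cball p (r + d) \<subseteq> (\<Union>x\<in>D. cball x (e x))"
  proof
    fix y assume y: "y \<in> cball p (r + d)"
    obtain c where c: "geodesic p y c" using geodesic_exists by blast
    define s where "s = min r (dist p y)"
    have s: "s \<in> {0..dist p y}" using r(2) by (simp add: s_def)
    then have ps: "dist p (c s) = s" and sy: "dist (c s) y \<le> d"
      using geodesic_point_dist[OF c s] y d by (auto simp: s_def)
    then have "c s \<in> cball p r" by (simp add: s_def)
    then obtain x where x: "x \<in> D" "dist x (c s) < e x / 2" using D(3) by auto
    then have "dist x y \<le> e x" using sy d_le[OF x(1)] dist_triangle[of x y "c s"] by simp
    then show "y \<in> (\<Union>x\<in>D. cball x (e x))" using x by auto
  qed
  moreover have "compact (\<Union>x\<in>D. cball x (e x))" using D(1) e(2) by auto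
  ultimately have "compact (cball p (r + d))"
    by (metis closed_cball compact_Int_closed inf.absorb_iff2)
  then show ?thesis using d by (intro exI[of _ "r + d"]) simp
qed

text \<open>The Hopf--Rinow argument: if \<open>R\<close> were the infimum of the radii of noncompact balls around
  \<open>p\<close>, then \<open>cball p R\<close> would be compact by the first of the preceding lemmas, and a ball of larger
  radius by the second.\<close>

theorem compact_cball_locally_compact_hadamard:
  fixes p :: "'y::hadamard_space"
  assumes lc: "locally_compact_space (euclidean :: 'y topology)"
  shows "compact (cball p r)"
proof (rule ccontr)
  assume r: "\<not> compact (cball p r)"
  define S where "S = {r. \<not> compact (cball p r)}"
  have mono: "compact (cball p s)" if "compact (cball p t)" "s \<le> t" for s t
    using compact_Int_closed[OF that(1) closed_cball[of p s]] that(2)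
    by (metis inf.absorb_iff2 subset_cball)
  have "0 \<le> s" if "s \<in> S" for s
    using that by (intro leI notI) (auto simp: S_def)
  then have bdd: "bdd_below S" by (meson bdd_belowI)
  have ne: "S \<noteq> {}" using r by (auto simp: S_def)
  define R where "R = Inf S"
  have "0 \<le> R" unfolding R_def using ne \<open>\<And>s. s \<in> S \<Longrightarrow> 0 \<le> s\<close> by (rule cInf_greatest)
  have "compact (cball p s)" if "s < R" for s
    using cInf_lower[OF _ bdd, of s] that by (force simp: R_def S_def)
  then have "compact (cball p R)" by (rule compact_cball_if_smaller)
  then obtain R' where R': "R' > R" "compact (cball p R')"
    using compact_cball_enlarge[OF lc] \<open>0 \<le> R\<close> by blast
  then obtain s where "s \<in> S" "s < R'" unfolding R_def
    using cInf_lessD[OF ne] by blast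
  then show False using mono[OF R'(2), of s] by (simp add: S_def)
qed

section \<open>The Dirichlet form of a weighted graph\<close>

lemma summable_on_abs_bound:
  fixes f g :: "'a \<Rightarrow> real"
  assumes "g summable_on A" "\<And>x. x \<in> A \<Longrightarrow> \<bar>f x\<bar> \<le> g x"
  shows "f summable_on A"
  by (rule abs_summable_summable, rule Infinite_Sum.abs_summable_on_comparison_test'[OF assms(1)])
     (use assms(2) in auto)

text \<open>An unordered sum is an integral over counting measure.\<close>

lemma infsum_dominated_convergence:
  fixes f :: "nat \<Rightarrow> 'a \<Rightarrow> real"
  assumes g: "g summable_on A"
    and bound: "\<And>n x. x \<in> A \<Longrightarrow> \<bar>f n x\<bar> \<le> g x"
    and lim: "\<And>x. x \<in> A \<Longrightarrow> (\<lambda>n. f n x) \<longlonglongrightarrow> h x"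
  shows "(\<lambda>n. infsum (f n) A) \<longlonglongrightarrow> infsum h A"
proof -
  have h_bound: "\<bar>h x\<bar> \<le> g x" if "x \<in> A" for x
    by (rule LIMSEQ_le_const2[OF tendsto_rabs[OF lim[OF that]]]) (use bound that in auto)
  have integral: "infsum k A = lebesgue_integral (count_space A) k" 
    and integrable: "integrable (count_space A) k"
    if "\<And>x. x \<in> A \<Longrightarrow> \<bar>k x\<bar> \<le> g x" for k :: "'a \<Rightarrow> real"
  proof -
    have "k summable_on A" using summable_on_abs_bound[OF g] that by blast
    then have k: "Infinite_Set_Sum.abs_summable_on k A"
      using summable_on_iff_abs_summable_on_real[of k A] abs_summable_equivalent[of k A] by blast
    then show "infsum k A = lebesgue_integral (count_space A) k"
      "integrable (count_space A) k"
      using infsetsum_infsum[OF k] by (simp_all add: infsetsum_def abs_summable_on_def)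
  qed
  have "(\<lambda>n. lebesgue_integral (count_space A) (f n)) \<longlonglongrightarrow> lebesgue_integral (count_space A) h"
  proof (rule integral_dominated_convergence)
    have "\<bar>g x\<bar> \<le> g x" if "x \<in> A" for x
      using bound[of x 0] that by simp
    then show "integrable (count_space A) g" by (rule integrable)
  qed (use bound lim in \<open>auto simp: AE_count_space\<close>)
  then show ?thesis
    using integral bound h_bound by simp
qed

context weighted_graph
begin

text \<open>The energy is a sum over ordered pairs of vertices, so each edge counts twice. Weight and
  gradient as functions of the pair make it a weighted square sum over one index.\<close>

definition pair_weight :: "'x \<times> 'x \<Rightarrow> real" where
  "pair_weight e = \<mu> (fst e) (snd e)"

definition gradient :: "('x \<Rightarrow> real) \<Rightarrow> 'x \<times> 'x \<Rightarrow> real" where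
  "gradient f e = f (fst e) - f (snd e)"

definition dirichlet_finite :: "('x \<Rightarrow> real) \<Rightarrow> bool" where
  "dirichlet_finite f \<longleftrightarrow> (\<lambda>e. pair_weight e * (gradient f e)\<^sup>2) summable_on UNIV"

definition dirichlet_form :: "('x \<Rightarrow> real) \<Rightarrow> ('x \<Rightarrow> real) \<Rightarrow> real" where
  "dirichlet_form f g = (\<Sum>\<^sub>\<infinity>e. pair_weight e * (gradient f e * gradient g e))"

definition dirichlet :: "('x \<Rightarrow> real) \<Rightarrow> real" where
  "dirichlet f = (\<Sum>\<^sub>\<infinity>e. pair_weight e * (gradient f e)\<^sup>2)"

text \<open>The Laplacian without its normalization: \<open>net_flow f x = m x * laplacian m \<mu> f x\<close>. So \<open>f\<close> is
  subharmonic if its net flow is nowhere positive.\<close>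

definition net_flow :: "('x \<Rightarrow> real) \<Rightarrow> 'x \<Rightarrow> real" where
  "net_flow f x = (\<Sum>\<^sub>\<infinity>y. \<mu> x y * (f x - f y))"

lemma pair_weight_nonneg: "0 \<le> pair_weight e"
  by (simp add: pair_weight_def edge_weight_nonneg)

lemma dirichlet_form_summable:
  assumes "dirichlet_finite f" "dirichlet_finite g"
  shows "(\<lambda>e. pair_weight e * (gradient f e * gradient g e)) summable_on UNIV"
proof (rule summable_on_abs_bound)
  show "(\<lambda>e. pair_weight e * (gradient f e)\<^sup>2 + pair_weight e * (gradient g e)\<^sup>2) summable_on UNIV"
    using assms unfolding dirichlet_finite_def by (intro summable_on_add)
  fix e
  have "\<bar>a * b\<bar> \<le> a\<^sup>2 + b\<^sup>2" for a b :: real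
  proof -
    have "2 * \<bar>a * b\<bar> \<le> a\<^sup>2 + b\<^sup>2"
      using sum_squares_bound[of "\<bar>a\<bar>" "\<bar>b\<bar>"] by (simp add: abs_mult)
    then show ?thesis using abs_ge_zero[of "a * b"] by linarith
  qed
  then have "pair_weight e * \<bar>gradient f e * gradient g e\<bar>
      \<le> pair_weight e * ((gradient f e)\<^sup>2 + (gradient g e)\<^sup>2)"
    by (intro mult_left_mono pair_weight_nonneg)
  then show "\<bar>pair_weight e * (gradient f e * gradient g e)\<bar>
      \<le> pair_weight e * (gradient f e)\<^sup>2 + pair_weight e * (gradient g e)\<^sup>2"
    using pair_weight_nonneg[of e] by (simp add: abs_mult distrib_left)
qed

lemma dirichlet_nonneg: "0 \<le> dirichlet f"
  unfolding dirichlet_def by (intro infsum_nonneg mult_nonneg_nonneg pair_weight_nonneg) simp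

lemma edge_le_dirichlet:
  assumes "dirichlet_finite f"
  shows "\<mu> x y * (f x - f y)\<^sup>2 \<le> dirichlet f"
proof -
  have "(\<Sum>e\<in>{(x, y)}. pair_weight e * (gradient f e)\<^sup>2) \<le> dirichlet f"
    unfolding dirichlet_def using assms
    by (intro finite_sum_le_infsum) (auto simp: dirichlet_finite_def pair_weight_nonneg)
  then show ?thesis by (simp add: gradient_def pair_weight_def)
qed

lemma dirichlet_contraction:
  assumes f: "dirichlet_finite f" and le: "\<And>x y. \<bar>g x - g y\<bar> \<le> \<bar>f x - f y\<bar>"
  shows "dirichlet_finite g" "dirichlet g \<le> dirichlet f"
proof -
  have *: "pair_weight e * (gradient g e)\<^sup>2 \<le> pair_weight e * (gradient f e)\<^sup>2" for e
    using le by (intro mult_left_mono pair_weight_nonneg)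
      (simp add: gradient_def abs_le_square_iff[symmetric])
  show g: "dirichlet_finite g"
    unfolding dirichlet_finite_def
    by (rule summable_on_abs_bound[OF f[unfolded dirichlet_finite_def]])
      (use * pair_weight_nonneg in \<open>simp add: abs_mult\<close>)
  show "dirichlet g \<le> dirichlet f"
    unfolding dirichlet_def
    by (rule infsum_mono) (use f g * in \<open>auto simp: dirichlet_finite_def\<close>)
qed

lemma dirichlet_const: "dirichlet_finite (\<lambda>_. c)" "dirichlet (\<lambda>_. c) = 0"
  by (simp_all add: dirichlet_finite_def dirichlet_def gradient_def)

lemma gradient_add: "gradient (\<lambda>x. f x + g x) e = gradient f e + gradient g e"
  by (simp add: gradient_def)

lemma gradient_cmult: "gradient (\<lambda>x. a * f x) e = a * gradient f e"
  by (simp add: gradient_def right_diff_distrib)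

lemma dirichlet_finite_cmult: "dirichlet_finite f \<Longrightarrow> dirichlet_finite (\<lambda>x. a * f x)"
  unfolding dirichlet_finite_def gradient_cmult power_mult_distrib mult.left_commute[of _ "a\<^sup>2"]
  by (rule summable_on_cmult_right)

lemma dirichlet_cmult: "dirichlet (\<lambda>x. a * f x) = a\<^sup>2 * dirichlet f"
  unfolding dirichlet_def gradient_cmult power_mult_distrib mult.left_commute[of _ "a\<^sup>2"]
  by (rule infsum_cmult_right')

lemma dirichlet_add:
  assumes f: "dirichlet_finite f" and g: "dirichlet_finite g"
  shows "dirichlet_finite (\<lambda>x. f x + g x)"
    "dirichlet (\<lambda>x. f x + g x) = dirichlet f + 2 * dirichlet_form f g + dirichlet g"
proof -
  have "pair_weight e * (gradient (\<lambda>x. f x + g x) e)\<^sup>2 = pair_weight e * (gradient f e)\<^sup>2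
      + 2 * (pair_weight e * (gradient f e * gradient g e)) + pair_weight e * (gradient g e)\<^sup>2" for e
    unfolding gradient_add by algebra
  moreover have "((\<lambda>e. pair_weight e * (gradient f e)\<^sup>2
      + 2 * (pair_weight e * (gradient f e * gradient g e)) + pair_weight e * (gradient g e)\<^sup>2)
    has_sum (dirichlet f + 2 * dirichlet_form f g + dirichlet g)) UNIV"
    using f g dirichlet_form_summable[OF f g]
    unfolding dirichlet_finite_def dirichlet_def dirichlet_form_def
    by (intro has_sum_add has_sum_cmult_right has_sum_infsum)
  ultimately have "((\<lambda>e. pair_weight e * (gradient (\<lambda>x. f x + g x) e)\<^sup>2)
    has_sum (dirichlet f + 2 * dirichlet_form f g + dirichlet g)) UNIV"
    by simp
  then show "dirichlet_finite (\<lambda>x. f x + g x)"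
    "dirichlet (\<lambda>x. f x + g x) = dirichlet f + 2 * dirichlet_form f g + dirichlet g"
    unfolding dirichlet_finite_def dirichlet_def[of "\<lambda>x. f x + g x"]
    by (auto simp: has_sum_iff)
qed

lemma dirichlet_form_add:
  assumes "dirichlet_finite f" "dirichlet_finite g" "dirichlet_finite h"
  shows "dirichlet_form f (\<lambda>x. g x + h x) = dirichlet_form f g + dirichlet_form f h"
proof -
  have "pair_weight e * (gradient f e * gradient (\<lambda>x. g x + h x) e)
     = pair_weight e * (gradient f e * gradient g e) + pair_weight e * (gradient f e * gradient h e)" for e
    unfolding gradient_add by algebra
  then show ?thesis
    using assms by (simp add: dirichlet_form_def infsum_add dirichlet_form_summable)
qed

lemma dirichlet_form_cmult: "dirichlet_form f (\<lambda>x. a * g x) = a * dirichlet_form f g"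
  unfolding dirichlet_form_def gradient_cmult mult.left_commute[of _ a]
  by (rule infsum_cmult_right')

lemma dirichlet_diff:
  assumes f: "dirichlet_finite f" and g: "dirichlet_finite g"
  shows "dirichlet_finite (\<lambda>x. f x - g x)"
    "dirichlet (\<lambda>x. f x - g x) = dirichlet f - 2 * dirichlet_form f g + dirichlet g"
  using dirichlet_add[OF f dirichlet_finite_cmult[OF g, of "-1"]]
    dirichlet_cmult[of "-1" g] dirichlet_form_cmult[of f "-1" g] by simp_all

lemma parallelogram:
  assumes "dirichlet_finite f" "dirichlet_finite g"
  shows "dirichlet (\<lambda>x. f x + g x) + dirichlet (\<lambda>x. f x - g x) = 2 * dirichlet f + 2 * dirichlet g"
  using dirichlet_add(2)[OF assms] dirichlet_diff(2)[OF assms] by simp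

lemma dirichlet_add_le:
  assumes "dirichlet_finite f" "dirichlet_finite g"
  shows "dirichlet (\<lambda>x. f x + g x) \<le> 2 * dirichlet f + 2 * dirichlet g"
  using parallelogram[OF assms] dirichlet_nonneg[of "\<lambda>x. f x - g x"] by linarith

text \<open>A function of finite energy is integrable along the edges at \<open>z\<close>, because
  \<open>\<bar>a\<bar> \<le> 1 + a\<^sup>2\<close> and the total weight at \<open>z\<close> is finite.\<close>

lemma row_summable:
  assumes f: "dirichlet_finite f"
  shows "(\<lambda>y. \<mu> z y * (f z - f y)) summable_on UNIV"
proof (rule summable_on_abs_bound)
  have "(\<lambda>e. pair_weight e * (gradient f e)\<^sup>2) summable_on (Pair z ` UNIV)"
    using f unfolding dirichlet_finite_def by (rule summable_on_subset_banach) simp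
  then have "(\<lambda>y. \<mu> z y * (f z - f y)\<^sup>2) summable_on UNIV"
    by (subst (asm) summable_on_reindex)
      (auto simp: inj_on_def o_def pair_weight_def gradient_def)
  then show "(\<lambda>y. \<mu> z y + \<mu> z y * (f z - f y)\<^sup>2) summable_on UNIV"
    by (intro summable_on_add edge_weight_summable)
  fix y
  have "\<bar>a\<bar> \<le> 1 + a\<^sup>2" for a :: real
    using sum_squares_bound[of "\<bar>a\<bar>" 1] by (simp add: abs_if split: if_splits)
  then have "\<mu> z y * \<bar>f z - f y\<bar> \<le> \<mu> z y * (1 + (f z - f y)\<^sup>2)"
    by (intro mult_left_mono edge_weight_nonneg)
  then show "\<bar>\<mu> z y * (f z - f y)\<bar> \<le> \<mu> z y + \<mu> z y * (f z - f y)\<^sup>2"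
    using edge_weight_nonneg[of z y] by (simp add: abs_mult distrib_left)
qed

text \<open>The gradient of the indicator of \<open>z\<close> lives on the pairs \<open>(z, y)\<close> and \<open>(y, z)\<close>; by symmetry of the
  weights both families contribute the net flow at \<open>z\<close>.\<close>

lemma green_indicator:
  assumes row: "(\<lambda>y. \<mu> z y * (f z - f y)) summable_on UNIV"
  shows "((\<lambda>e. pair_weight e * (gradient f e * gradient (indicator {z}) e))
    has_sum 2 * net_flow f z) UNIV"
proof -
  let ?s = "\<lambda>y. \<mu> z y * (f z - f y)"
  have row': "(?s has_sum net_flow f z) UNIV"
    using row by (simp add: net_flow_def)
  have out: "((\<lambda>e. if fst e = z then ?s (snd e) else 0) has_sum net_flow f z) UNIV"
  proof -
    have "((\<lambda>e. ?s (snd e)) has_sum net_flow f z) (Pair z ` UNIV)"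
      using row' by (subst has_sum_reindex) (auto simp: inj_on_def o_def)
    then show ?thesis
      by (rule has_sum_cong_neutral[THEN iffD1, rotated -1]) auto
  qed
  have into: "((\<lambda>e. if snd e = z then ?s (fst e) else 0) has_sum net_flow f z) UNIV"
  proof -
    have "((\<lambda>e. ?s (fst e)) has_sum net_flow f z) ((\<lambda>y. (y, z)) ` UNIV)"
      using row' by (subst has_sum_reindex) (auto simp: inj_on_def o_def)
    then show ?thesis
      by (rule has_sum_cong_neutral[THEN iffD1, rotated -1]) auto
  qed
  have "pair_weight e * (gradient f e * gradient (indicator {z}) e)
    = (if fst e = z then ?s (snd e) else 0) + (if snd e = z then ?s (fst e) else 0)" for e
    using edge_weight_sym[of "fst e" "snd e"]
    by (auto simp: gradient_def pair_weight_def indicator_def)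
  then show ?thesis
    using has_sum_add[OF out into] by simp
qed

lemma dirichlet_finite_indicator: "dirichlet_finite (indicator {z})"
proof -
  have "(\<lambda>y. \<mu> z y * (indicator {z} z - indicator {z} y)) summable_on UNIV"
    by (rule summable_on_abs_bound[OF edge_weight_summable[of z]])
      (auto simp: indicator_def edge_weight_nonneg)
  from green_indicator[OF this] show ?thesis
    unfolding dirichlet_finite_def power2_eq_square by (rule has_sum_imp_summable)
qed

lemma green_formula:
  assumes f: "dirichlet_finite f" and S: "finite {x. \<phi> x \<noteq> 0}"
  shows "dirichlet_finite \<phi>"
    "dirichlet_form f \<phi> = 2 * (\<Sum>x | \<phi> x \<noteq> 0. \<phi> x * net_flow f x)"
proof -
  define k :: "'x \<Rightarrow> 'x \<Rightarrow> real" where "k z = indicator {z}" for z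
  have k: "dirichlet_finite (k z)" for z
    unfolding k_def by (rule dirichlet_finite_indicator)
  have form_k: "dirichlet_form f (k z) = 2 * net_flow f z" for z
    unfolding dirichlet_form_def k_def
    by (rule infsumI[OF green_indicator[OF row_summable[OF f]]])
  have "dirichlet_finite (\<lambda>x. \<Sum>z\<in>S. a z * k z x) \<and>
    dirichlet_form f (\<lambda>x. \<Sum>z\<in>S. a z * k z x) = 2 * (\<Sum>z\<in>S. a z * net_flow f z)"
    if "finite S" for S and a :: "'x \<Rightarrow> real"
    using that
  proof induction
    case empty
    show ?case by (simp add: dirichlet_const) (simp add: dirichlet_form_def gradient_def)
  next
    case (insert s S)
    then show ?case
      by (simp add: dirichlet_add dirichlet_form_add f dirichlet_finite_cmult k
          dirichlet_form_cmult form_k distrib_left)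
  qed
  note * = this[OF S, of \<phi>]
  moreover have "(\<lambda>x. \<Sum>z | \<phi> z \<noteq> 0. \<phi> z * k z x) = \<phi>"
  proof
    fix x
    have "(\<Sum>z | \<phi> z \<noteq> 0. \<phi> z * k z x) = (\<Sum>z | \<phi> z \<noteq> 0. if z = x then \<phi> x else 0)"
      by (intro sum.cong) (auto simp: k_def indicator_def)
    then show "(\<Sum>z | \<phi> z \<noteq> 0. \<phi> z * k z x) = \<phi> x"
      using S by simp
  qed
  ultimately show "dirichlet_finite \<phi>"
    "dirichlet_form f \<phi> = 2 * (\<Sum>x | \<phi> x \<noteq> 0. \<phi> x * net_flow f x)"
    by simp_all
qed

lemma finite_support_dirichlet_finite: "finite {x. \<phi> x \<noteq> 0} \<Longrightarrow> dirichlet_finite \<phi>"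
  by (rule green_formula(1)[OF dirichlet_const(1)[of 0]])

end

section \<open>Truncations of subharmonic functions\<close>

text \<open>Along one edge, with values \<open>a\<close>, \<open>b\<close> of \<open>f\<close> and \<open>p\<close>, \<open>q\<close> of \<open>v\<close>, let \<open>\<Delta>\<close>, \<open>A\<close> and \<open>d\<close> be the
  increments of the positive part of \<open>min f N - v\<close>, of \<open>min f N\<close> and of \<open>v\<close>. Taking
  positive parts contracts increments and keeps their sign, so \<open>\<Delta>\<close> lies between \<open>0\<close> and \<open>A - d\<close>, and
  \<open>A\<close> lies between \<open>0\<close> and the increment of \<open>f\<close>. Without \<open>v\<close> this says \<open>\<Delta>\<^sup>2 \<le> (a - b) \<Delta>\<close>; the
  other terms bound the error caused by \<open>v\<close>.\<close>

lemma truncation_edge_inequality: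
  fixes a b p q N :: real
  defines "\<alpha> \<equiv> max 0 (min a N - p)" and "\<beta> \<equiv> max 0 (min b N - q)"
  shows "(\<alpha> - \<beta>)\<^sup>2 \<le> (a - b) * (\<alpha> - \<beta>) + \<bar>a - b\<bar> * \<bar>p - q\<bar> + (p - q)\<^sup>2"
proof -
  have main: "(max 0 (min a N - p) - max 0 (min b N - q))\<^sup>2
      \<le> (a - b) * (max 0 (min a N - p) - max 0 (min b N - q)) + (a - b) * \<bar>p - q\<bar> + (p - q)\<^sup>2"
    if "b \<le> a" for a b p q :: real
  proof -
    define \<Delta> where "\<Delta> = max 0 (min a N - p) - max 0 (min b N - q)"
    define A where "A = min a N - min b N"
    define d where "d = p - q"
    have A: "0 \<le> A" "A \<le> a - b" using that by (auto simp: A_def)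
    have \<Delta>: "0 \<le> \<Delta> \<and> \<Delta> \<le> A - d \<or> \<Delta> \<le> 0 \<and> A - d \<le> \<Delta>"
    proof -
      have "0 \<le> max 0 r - max 0 s \<and> max 0 r - max 0 s \<le> r - s
          \<or> max 0 r - max 0 s \<le> 0 \<and> r - s \<le> max 0 r - max 0 s" for r s :: real
        by (auto simp: max_def)
      from this[of "min a N - p" "min b N - q"] show ?thesis
        unfolding \<Delta>_def A_def d_def by (simp add: algebra_simps)
    qed
    have "\<Delta>\<^sup>2 \<le> (a - b) * \<Delta> + (a - b) * \<bar>d\<bar> + d\<^sup>2"
      using \<Delta>
    proof
      assume *: "0 \<le> \<Delta> \<and> \<Delta> \<le> A - d"
      have "\<Delta>\<^sup>2 \<le> \<Delta> * (A - d)"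
        unfolding power2_eq_square using * by (intro mult_left_mono) auto
      also have "\<dots> = \<Delta> * A - \<Delta> * d" by algebra
      also have "\<dots> \<le> \<Delta> * (a - b) + \<Delta> * \<bar>d\<bar>"
        using * A mult_left_mono[of A "a - b" \<Delta>] mult_left_mono[OF abs_ge_minus_self[of d], of \<Delta>] by simp
      also have "\<Delta> * \<bar>d\<bar> \<le> ((a - b) + \<bar>d\<bar>) * \<bar>d\<bar>"
        using * A by (intro mult_right_mono) auto
      finally show ?thesis by (simp add: power2_eq_square algebra_simps)
    next
      assume *: "\<Delta> \<le> 0 \<and> A - d \<le> \<Delta>"
      then have d: "d \<ge> A" by simp
      have "\<Delta>\<^sup>2 - (a - b) * \<Delta> = - \<Delta> * ((a - b) - \<Delta>)"
        by (simp add: power2_eq_square algebra_simps)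
      also have "\<dots> \<le> d * ((a - b) + d)"
        using * A d by (intro mult_mono) auto
      finally show ?thesis using d A by (simp add: power2_eq_square algebra_simps)
    qed
    then show ?thesis by (simp add: \<Delta>_def d_def)
  qed
  show ?thesis
  proof (cases "b \<le> a")
    case True
    then show ?thesis using main[OF True, of p q] by (simp add: \<alpha>_def \<beta>_def)
  next
    case False
    then have "a \<le> b" by simp
    from main[OF this, of q p] show ?thesis
      using False by (simp add: \<alpha>_def \<beta>_def power2_commute abs_minus_commute algebra_simps)
  qed
qed

text \<open>The product of countably many copies of a compact interval is compact and metrizable.\<close>

lemma bounded_functions_subsequence:
  fixes v :: "nat \<Rightarrow> 'x::countable \<Rightarrow> real"
  assumes "\<And>n x. v n x \<in> {a..b}"
  obtains r :: "nat \<Rightarrow> nat" and l where "strict_mono r" "\<And>x. (\<lambda>n. v (r n) x) \<longlonglongrightarrow> l x"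
proof -
  have "compact (PiE UNIV (\<lambda>_::'x. {a..b}))"
    using compactin_PiE[of "\<lambda>_::'x. euclideanreal" UNIV "\<lambda>_. {a..b}"]
    by (simp add: euclidean_product_topology)
  then have "seq_compact (PiE UNIV (\<lambda>_::'x. {a..b}))"
    by (rule compact_imp_seq_compact)
  moreover have "\<forall>n. v n \<in> PiE UNIV (\<lambda>_::'x. {a..b})"
    using assms by (auto simp: PiE_def Pi_def extensional_def)
  ultimately obtain l r where r: "strict_mono (r :: nat \<Rightarrow> nat)" and l: "(v \<circ> r) \<longlonglongrightarrow> l"
    unfolding seq_compact_def by blast
  have "(\<lambda>n. v (r n) x) \<longlonglongrightarrow> l x" for x
  proof -
    have "continuous_on UNIV (\<lambda>f :: 'x \<Rightarrow> real. f x)" by simp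
    then have "isCont (\<lambda>f :: 'x \<Rightarrow> real. f x) l"
      using continuous_on_eq_continuous_at[OF open_UNIV, of "\<lambda>f :: 'x \<Rightarrow> real. f x"] by blast
    from isCont_tendsto_compose[OF this l] show ?thesis by (simp add: o_def)
  qed
  with r show thesis by (rule that)
qed

context weighted_graph
begin

text \<open>Since \<open>\<phi>\<close> is nonnegative and finitely supported and \<open>f\<close> is subharmonic, Green's formula makes the
  mixed energy of \<open>f\<close> and \<open>\<phi>\<close> nonpositive. Summing the edge inequality over all pairs bounds the energy
  of \<open>\<phi>\<close> by error terms; \<open>t\<close> is the weight in Young's inequality for the product
  \<open>\<bar>gradient f e\<bar> * \<bar>gradient v e\<bar>\<close>.\<close>

lemma truncated_difference_energy:
  assumes f: "dirichlet_finite f" and subharmonic: "\<And>x. net_flow f x \<le> 0"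
    and v: "dirichlet_finite v" and support: "finite {x. min (f x) N - v x \<noteq> 0}" and t: "0 < t"
  defines "\<phi> \<equiv> \<lambda>x. max 0 (min (f x) N - v x)"
  shows "dirichlet \<phi> \<le> t * dirichlet f + (1 + 1 / t) * dirichlet v"
proof -
  have \<phi>_support: "finite {x. \<phi> x \<noteq> 0}"
    by (rule finite_subset[OF _ support]) (auto simp: \<phi>_def)
  note \<phi> = finite_support_dirichlet_finite[OF this]
  have "dirichlet_form f \<phi> = 2 * (\<Sum>x | \<phi> x \<noteq> 0. \<phi> x * net_flow f x)"
    by (rule green_formula(2)[OF f \<phi>_support])
  also have "\<dots> \<le> 0"
    using subharmonic by (auto intro!: sum_nonpos mult_nonneg_nonpos simp: \<phi>_def)
  finally have nonpos: "dirichlet_form f \<phi> \<le> 0" .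
  let ?rhs = "\<lambda>e. pair_weight e * (gradient f e * gradient \<phi> e)
    + (t * (pair_weight e * (gradient f e)\<^sup>2) + (1 + 1 / t) * (pair_weight e * (gradient v e)\<^sup>2))"
  have rhs: "(?rhs has_sum dirichlet_form f \<phi> + (t * dirichlet f + (1 + 1 / t) * dirichlet v)) UNIV"
    using f v dirichlet_form_summable[OF f \<phi>]
    unfolding dirichlet_finite_def dirichlet_def dirichlet_form_def
    by (intro has_sum_add has_sum_cmult_right has_sum_infsum)
  have "pair_weight e * (gradient \<phi> e)\<^sup>2 \<le> ?rhs e" for e
  proof -
    have "(gradient \<phi> e)\<^sup>2 \<le> gradient f e * gradient \<phi> e + \<bar>gradient f e\<bar> * \<bar>gradient v e\<bar> + (gradient v e)\<^sup>2"
      using truncation_edge_inequality[of "f (fst e)" N "v (fst e)" "f (snd e)" "v (snd e)"]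
      by (simp add: gradient_def \<phi>_def)
    also have "\<bar>gradient f e\<bar> * \<bar>gradient v e\<bar> \<le> t * (gradient f e)\<^sup>2 + 1 / t * (gradient v e)\<^sup>2"
    proof -
      have "a * b \<le> t * a\<^sup>2 + 1 / t * b\<^sup>2" if "0 \<le> a" "0 \<le> b" for a b
      proof -
        have "0 \<le> t * (a * b)" "2 * (t * (a * b)) \<le> (t * a)\<^sup>2 + b\<^sup>2"
          using that t sum_squares_bound[of "t * a" b] by (simp_all add: mult.assoc)
        then have "t * (a * b) \<le> (t * a)\<^sup>2 + b\<^sup>2" by linarith
        also have "\<dots> = t * (t * a\<^sup>2 + 1 / t * b\<^sup>2)"
          using t by (simp add: field_simps power2_eq_square)
        finally show ?thesis using t by simp
      qed
      from this[of "\<bar>gradient f e\<bar>" "\<bar>gradient v e\<bar>"] show ?thesis by simp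
    qed
    finally have "pair_weight e * (gradient \<phi> e)\<^sup>2 \<le> pair_weight e *
        (gradient f e * gradient \<phi> e + (t * (gradient f e)\<^sup>2 + 1 / t * (gradient v e)\<^sup>2) + (gradient v e)\<^sup>2)"
      by (intro mult_left_mono pair_weight_nonneg) simp
    also have "\<dots> = ?rhs e" by (simp add: algebra_simps)
    finally show ?thesis .
  qed
  then have "dirichlet \<phi> \<le> dirichlet_form f \<phi> + (t * dirichlet f + (1 + 1 / t) * dirichlet v)"
    using \<phi> rhs unfolding dirichlet_def[of \<phi>] dirichlet_finite_def
    by (intro has_sum_mono[OF has_sum_infsum rhs]) auto
  then show ?thesis using nonpos by simp
qed

text \<open>Membership in the closure of the finitely supported functions with respect to pointwise
  convergence together with convergence in energy.\<close>

definition finitely_approximable :: "('x \<Rightarrow> real) \<Rightarrow> bool" where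
  "finitely_approximable g \<longleftrightarrow> dirichlet_finite g \<and>
    (\<exists>\<psi>. (\<forall>n. finite {x. \<psi> n x \<noteq> 0}) \<and> (\<forall>x. (\<lambda>n. \<psi> n x) \<longlonglongrightarrow> g x) \<and>
      (\<lambda>n::nat. dirichlet (\<lambda>x. g x - \<psi> n x)) \<longlonglongrightarrow> 0)"

lemma finitely_approximable_cmult:
  assumes "finitely_approximable g"
  shows "finitely_approximable (\<lambda>x. a * g x)"
proof -
  obtain \<psi> where \<psi>: "\<And>n. finite {x. \<psi> n x \<noteq> 0}" "\<And>x. (\<lambda>n. \<psi> n x) \<longlonglongrightarrow> g x"
      "(\<lambda>n::nat. dirichlet (\<lambda>x. g x - \<psi> n x)) \<longlonglongrightarrow> 0" and g: "dirichlet_finite g"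
    using assms by (auto simp: finitely_approximable_def)
  have "finite {x. a * \<psi> n x \<noteq> 0}" for n
    by (rule finite_subset[OF _ \<psi>(1)[of n]]) auto
  moreover have "(\<lambda>n. a * \<psi> n x) \<longlonglongrightarrow> a * g x" for x
    by (intro tendsto_intros \<psi>)
  moreover have "(\<lambda>n. dirichlet (\<lambda>x. a * g x - a * \<psi> n x)) \<longlonglongrightarrow> 0"
    using tendsto_mult_left[OF \<psi>(3), of "a\<^sup>2"] dirichlet_cmult[of a "\<lambda>x. g x - \<psi> n x" for n]
    by (simp add: right_diff_distrib)
  ultimately show ?thesis
    unfolding finitely_approximable_def using dirichlet_finite_cmult[OF g, of a]
    by (intro conjI exI[of _ "\<lambda>n x. a * \<psi> n x"]) auto
qed

lemma finitely_approximable_diff: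
  assumes "finitely_approximable g" "finitely_approximable h"
  shows "finitely_approximable (\<lambda>x. g x - h x)"
proof -
  obtain \<psi> where \<psi>: "\<And>n. finite {x. \<psi> n x \<noteq> 0}" "\<And>x. (\<lambda>n. \<psi> n x) \<longlonglongrightarrow> g x"
      "(\<lambda>n::nat. dirichlet (\<lambda>x. g x - \<psi> n x)) \<longlonglongrightarrow> 0" and g: "dirichlet_finite g"
    using assms(1) by (auto simp: finitely_approximable_def)
  obtain \<phi> where \<phi>: "\<And>n. finite {x. \<phi> n x \<noteq> 0}" "\<And>x. (\<lambda>n. \<phi> n x) \<longlonglongrightarrow> h x"
      "(\<lambda>n::nat. dirichlet (\<lambda>x. h x - \<phi> n x)) \<longlonglongrightarrow> 0" and h: "dirichlet_finite h"
    using assms(2) by (auto simp: finitely_approximable_def)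
  have "finite {x. \<psi> n x - \<phi> n x \<noteq> 0}" for n
    by (rule finite_subset[OF _ finite_UnI[OF \<psi>(1)[of n] \<phi>(1)[of n]]]) auto
  moreover have "(\<lambda>n. \<psi> n x - \<phi> n x) \<longlonglongrightarrow> g x - h x" for x
    by (intro tendsto_intros \<psi> \<phi>)
  moreover have "(\<lambda>n. dirichlet (\<lambda>x. (g x - h x) - (\<psi> n x - \<phi> n x))) \<longlonglongrightarrow> 0"
  proof (rule tendsto_sandwich[OF _ _ tendsto_const])
    show "\<forall>\<^sub>F n in sequentially. dirichlet (\<lambda>x. (g x - h x) - (\<psi> n x - \<phi> n x))
      \<le> 2 * dirichlet (\<lambda>x. g x - \<psi> n x) + 2 * dirichlet (\<lambda>x. h x - \<phi> n x)"
    proof (intro always_eventually allI)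
      fix n
      have d: "dirichlet_finite (\<lambda>x. g x - \<psi> n x)" "dirichlet_finite (\<lambda>x. h x - \<phi> n x)"
        by (rule dirichlet_diff(1)[OF g finite_support_dirichlet_finite[OF \<psi>(1)]],
            rule dirichlet_diff(1)[OF h finite_support_dirichlet_finite[OF \<phi>(1)]])
      have eq: "(\<lambda>x. (g x - h x) - (\<psi> n x - \<phi> n x)) = (\<lambda>x. (g x - \<psi> n x) - (h x - \<phi> n x))"
        by (auto simp: fun_eq_iff)
      show "dirichlet (\<lambda>x. (g x - h x) - (\<psi> n x - \<phi> n x))
        \<le> 2 * dirichlet (\<lambda>x. g x - \<psi> n x) + 2 * dirichlet (\<lambda>x. h x - \<phi> n x)"
        unfolding eq using parallelogram[OF d] dirichlet_nonneg[of "\<lambda>x. (g x - \<psi> n x) + (h x - \<phi> n x)"]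
        by linarith
    qed
    show "(\<lambda>n. 2 * dirichlet (\<lambda>x. g x - \<psi> n x) + 2 * dirichlet (\<lambda>x. h x - \<phi> n x)) \<longlonglongrightarrow> 0"
      using tendsto_add[OF tendsto_mult_left[OF \<psi>(3), of 2] tendsto_mult_left[OF \<phi>(3), of 2]] by simp
  qed (simp add: dirichlet_nonneg)
  ultimately show ?thesis
    unfolding finitely_approximable_def using dirichlet_diff(1)[OF g h]
    by (intro conjI exI[of _ "\<lambda>n x. \<psi> n x - \<phi> n x"]) auto
qed

text \<open>Approximate \<open>min f N - w\<close> by finitely supported \<open>\<psi> n\<close>, apply the previous energy estimate to
  \<open>v n = min f N - \<psi> n\<close>, and let \<open>n\<close> tend to infinity: \<open>v n\<close> tends to \<open>w\<close> pointwise and in energy.\<close>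

lemma truncation_edge_bound:
  assumes f: "dirichlet_finite f" and subharmonic: "\<And>x. net_flow f x \<le> 0"
    and w: "dirichlet_finite w" and approx: "finitely_approximable (\<lambda>x. min (f x) N - w x)" and t: "0 < t"
  shows "\<mu> x y * (max 0 (min (f x) N - w x) - max 0 (min (f y) N - w y))\<^sup>2
    \<le> t * dirichlet f + (1 + 1 / t) * (2 * dirichlet w)"
proof -
  obtain \<psi> where \<psi>: "\<And>n. finite {x. \<psi> n x \<noteq> 0}" "\<And>x. (\<lambda>n. \<psi> n x) \<longlonglongrightarrow> min (f x) N - w x"
      "(\<lambda>n::nat. dirichlet (\<lambda>x. min (f x) N - w x - \<psi> n x)) \<longlonglongrightarrow> 0"
    and fw: "dirichlet_finite (\<lambda>x. min (f x) N - w x)"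
    using approx by (auto simp: finitely_approximable_def)
  define v where "v n x = min (f x) N - \<psi> n x" for n x
  define E where "E n = dirichlet (\<lambda>x. min (f x) N - w x - \<psi> n x)" for n
  have v: "dirichlet_finite (v n)" and Ev: "dirichlet (v n) \<le> 2 * E n + 2 * dirichlet w" for n
  proof -
    have d: "dirichlet_finite (\<lambda>x. min (f x) N - w x - \<psi> n x)"
      by (rule dirichlet_diff(1)[OF fw finite_support_dirichlet_finite[OF \<psi>(1)]])
    have eq: "v n = (\<lambda>x. (min (f x) N - w x - \<psi> n x) + w x)"
      by (auto simp: v_def)
    show "dirichlet_finite (v n)" "dirichlet (v n) \<le> 2 * E n + 2 * dirichlet w"
      unfolding eq E_def using dirichlet_add(1)[OF d w] dirichlet_add_le[OF d w] by auto
  qed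
  have support: "finite {x. min (f x) N - v n x \<noteq> 0}" for n
    using \<psi>(1)[of n] by (simp add: v_def)
  let ?\<phi> = "\<lambda>n x. max 0 (min (f x) N - v n x)"
  have bound: "\<mu> x y * (?\<phi> n x - ?\<phi> n y)\<^sup>2
    \<le> t * dirichlet f + (1 + 1 / t) * (2 * E n + 2 * dirichlet w)" for n
  proof -
    have "dirichlet_finite (?\<phi> n)"
      by (intro finite_support_dirichlet_finite finite_subset[OF _ support[of n]]) auto
    then have "\<mu> x y * (?\<phi> n x - ?\<phi> n y)\<^sup>2 \<le> dirichlet (?\<phi> n)"
      by (rule edge_le_dirichlet)
    also have "\<dots> \<le> t * dirichlet f + (1 + 1 / t) * dirichlet (v n)"
      by (rule truncated_difference_energy[OF f subharmonic v support t])
    also have "\<dots> \<le> t * dirichlet f + (1 + 1 / t) * (2 * E n + 2 * dirichlet w)"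
      using Ev[of n] t by (intro add_left_mono mult_left_mono) auto
    finally show ?thesis .
  qed
  have "(\<lambda>n. v n x) \<longlonglongrightarrow> w x" for x
    using tendsto_diff[OF tendsto_const \<psi>(2)[of x], of "min (f x) N"] by (simp add: v_def)
  then have "(\<lambda>n. \<mu> x y * (?\<phi> n x - ?\<phi> n y)\<^sup>2)
    \<longlonglongrightarrow> \<mu> x y * (max 0 (min (f x) N - w x) - max 0 (min (f y) N - w y))\<^sup>2"
    by (intro tendsto_intros)
  moreover have "(\<lambda>n. t * dirichlet f + (1 + 1 / t) * (2 * E n + 2 * dirichlet w))
    \<longlonglongrightarrow> t * dirichlet f + (1 + 1 / t) * (2 * 0 + 2 * dirichlet w)"
    using \<psi>(3) by (intro tendsto_intros) (simp add: E_def)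
  ultimately show ?thesis
    using LIMSEQ_le bound by (metis (no_types, lifting) add.left_neutral mult_zero_right)
qed

lemma net_flow_tendsto:
  assumes bound: "\<And>n x. \<bar>v n x\<bar> \<le> B" and lim: "\<And>x. (\<lambda>n. v n x) \<longlonglongrightarrow> l x"
  shows "(\<lambda>n. net_flow (v n) z) \<longlonglongrightarrow> net_flow l z"
  unfolding net_flow_def
proof (rule infsum_dominated_convergence)
  show "(\<lambda>y. \<mu> z y * (2 * B)) summable_on UNIV"
    by (intro summable_on_cmult_left edge_weight_summable)
  fix n y
  have "\<bar>v n z - v n y\<bar> \<le> 2 * B" using bound[of n z] bound[of n y] by linarith
  then show "\<bar>\<mu> z y * (v n z - v n y)\<bar> \<le> \<mu> z y * (2 * B)"
    by (simp add: abs_mult edge_weight_nonneg mult_left_mono)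
qed (intro tendsto_intros lim)

text \<open>Finite partial sums of the energy are continuous under pointwise convergence.\<close>

lemma dirichlet_fatou:
  assumes v: "\<And>n. dirichlet_finite (v n)" and lim: "\<And>x. (\<lambda>n. v n x) \<longlonglongrightarrow> l x"
    and le: "\<forall>\<^sub>F n in sequentially. dirichlet (v n) \<le> C"
  shows "dirichlet_finite l" "dirichlet l \<le> C"
proof -
  have part: "(\<Sum>e\<in>F. pair_weight e * (gradient l e)\<^sup>2) \<le> C" if "finite F" for F
  proof (rule tendsto_upperbound)
    show "(\<lambda>n. \<Sum>e\<in>F. pair_weight e * (gradient (v n) e)\<^sup>2)
        \<longlonglongrightarrow> (\<Sum>e\<in>F. pair_weight e * (gradient l e)\<^sup>2)"
      unfolding gradient_def by (intro tendsto_intros lim)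
    show "\<forall>\<^sub>F n in sequentially. (\<Sum>e\<in>F. pair_weight e * (gradient (v n) e)\<^sup>2) \<le> C"
      using le
    proof eventually_elim
      case (elim n)
      have "(\<Sum>e\<in>F. pair_weight e * (gradient (v n) e)\<^sup>2) \<le> dirichlet (v n)"
        unfolding dirichlet_def using v[of n] that
        by (intro finite_sum_le_infsum) (auto simp: dirichlet_finite_def pair_weight_nonneg)
      then show ?case using elim by simp
    qed
  qed simp
  show fin: "dirichlet_finite l"
    unfolding dirichlet_finite_def using part
    by (intro nonneg_bdd_above_summable_on bdd_aboveI2[where M = C]) (auto simp: pair_weight_nonneg)
  show "dirichlet l \<le> C"
    unfolding dirichlet_def using fin part
    by (intro infsum_le_finite_sums) (auto simp: dirichlet_finite_def)
qed

text \<open>The first variation of the energy at \<open>v n\<close> in the direction of the indicator of \<open>z\<close> is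
  proportional to the net flow at \<open>z\<close>. Along a minimizing sequence it has to vanish in the limit.\<close>

lemma minimizing_limit_flow_free:
  assumes v: "\<And>n. dirichlet_finite (v n)"
    and min: "\<And>n \<psi>. finite {x. \<psi> x \<noteq> 0} \<Longrightarrow> I \<le> dirichlet (\<lambda>x. v n x + \<psi> x)"
    and lim: "(\<lambda>n. dirichlet (v n)) \<longlonglongrightarrow> I"
    and flow: "(\<lambda>n. net_flow (v n) z) \<longlonglongrightarrow> L"
  shows "L = 0"
proof -
  define D where "D = dirichlet (indicator {z})"
  have ge: "0 \<le> 4 * s * L + s\<^sup>2 * D" for s
  proof -
    have "I \<le> dirichlet (v n) + 2 * (s * (2 * net_flow (v n) z)) + s\<^sup>2 * D" for n
    proof -
      have fin: "finite {x. s * indicator {z} x \<noteq> (0::real)}"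
        by (rule finite_subset[of _ "{z}"]) (auto simp: indicator_def)
      have form: "dirichlet_form (v n) (indicator {z}) = 2 * net_flow (v n) z"
        unfolding dirichlet_form_def
        by (rule infsumI[OF green_indicator[OF row_summable[OF v]]])
      have "I \<le> dirichlet (\<lambda>x. v n x + s * indicator {z} x)"
        by (rule min[OF fin])
      also have "\<dots> = dirichlet (v n) + 2 * (s * (2 * net_flow (v n) z)) + s\<^sup>2 * D"
        by (simp add: dirichlet_add(2)[OF v finite_support_dirichlet_finite[OF fin]]
            dirichlet_form_cmult dirichlet_cmult form D_def)
      finally show ?thesis .
    qed
    moreover have "(\<lambda>n. dirichlet (v n) + 2 * (s * (2 * net_flow (v n) z)) + s\<^sup>2 * D)
        \<longlonglongrightarrow> I + 2 * (s * (2 * L)) + s\<^sup>2 * D"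
      by (intro tendsto_intros lim flow)
    ultimately have "I \<le> I + 2 * (s * (2 * L)) + s\<^sup>2 * D"
      by (intro LIMSEQ_le_const) auto
    then show ?thesis by simp
  qed
  have "D \<ge> 0" by (simp add: D_def dirichlet_nonneg)
  \<comment> \<open>The bound is optimal at \<open>s = - 2 L / D\<close>; half of this value suffices, and \<open>D + 1\<close> avoids dividing by zero.\<close>
  have "0 \<le> - 4 * L\<^sup>2 / (D + 1) + L\<^sup>2 * D / (D + 1)\<^sup>2"
    using ge[of "- L / (D + 1)"] by (simp add: power2_eq_square)
  also have "\<dots> \<le> - 4 * L\<^sup>2 / (D + 1) + L\<^sup>2 / (D + 1)"
  proof -
    have "L\<^sup>2 * D / (D + 1)\<^sup>2 \<le> L\<^sup>2 * (D + 1) / (D + 1)\<^sup>2"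
      using \<open>D \<ge> 0\<close> by (intro divide_right_mono mult_left_mono) auto
    then show ?thesis using \<open>D \<ge> 0\<close> by (simp add: power2_eq_square)
  qed
  also have "\<dots> = - 3 * L\<^sup>2 / (D + 1)"
    by (simp add: field_simps)
  finally show "L = 0"
    using \<open>D \<ge> 0\<close> by (simp add: field_simps zero_le_divide_iff)
qed

end

section \<open>Subharmonic functions of finite energy are bounded\<close>

text \<open>The condition on isolated vertices excludes only the graph with a single vertex; it makes the
  transition probabilities sum to one.\<close>

locale liouville_graph = weighted_graph m \<mu>
  for m :: "'x::countable \<Rightarrow> real" and \<mu> :: "'x \<Rightarrow> 'x \<Rightarrow> real" +
  assumes connected: "connected_graph \<mu>"
    and no_isolated_vertex: "0 < (\<Sum>\<^sub>\<infinity>y. \<mu> x y)"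
    and liouville: "harmonic_function m \<mu> f \<Longrightarrow> bounded (range f) \<Longrightarrow> f constant_on UNIV"
begin

lemma constant_if_flow_free:
  assumes bound: "\<And>x. \<bar>f x\<bar> \<le> B" and free: "\<And>x. net_flow f x = 0"
  obtains c where "f = (\<lambda>_. c)"
proof -
  have "(\<lambda>y. \<mu> x y * \<bar>f y\<bar>) summable_on UNIV" for x
  proof (rule summable_on_abs_bound)
    show "(\<lambda>y. \<mu> x y * B) summable_on UNIV"
      by (intro summable_on_cmult_left edge_weight_summable)
  qed (use bound in \<open>auto simp: abs_mult edge_weight_nonneg intro!: mult_left_mono\<close>)
  then have "harmonic_function m \<mu> f"
    using free by (simp add: harmonic_function_def laplacian_domain_def laplacian_def net_flow_def)
  moreover have "bounded (range f)"
    using bound by (auto simp: bounded_iff)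
  ultimately have "f constant_on UNIV" by (rule liouville)
  then obtain c where "f = (\<lambda>_. c)" by (auto simp: constant_on_def)
  then show ?thesis by (rule that)
qed

lemma constant_if_constant_along_edges:
  assumes "\<And>x y. 0 < \<mu> x y \<Longrightarrow> g x = g y"
  shows "g x = g y"
proof -
  have "(\<lambda>a b. \<mu> a b > 0)\<^sup>*\<^sup>* x y"
    using connected by (simp add: connected_graph_def)
  then show ?thesis by induction (use assms in auto)
qed

text \<open>Let \<open>v n\<close> be a minimizing sequence for the energy among the functions that differ from \<open>g\<close> at
  finitely many vertices. Clipping to \<open>{0..N}\<close> does not increase the energy and keeps
  the finite difference from \<open>g\<close>, so a subsequence converges pointwise. Its limit is bounded and harmonic,
  hence a constant \<open>c\<close>. By the parallelogram identity the sequence is Cauchy in energy, so by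
  Fatou's lemma it also converges to \<open>c\<close> in energy.\<close>

lemma approximable_up_to_constant:
  assumes g: "dirichlet_finite g" and range: "\<And>x. g x \<in> {0..N}"
  obtains c where "c \<in> {0..N}" "finitely_approximable (\<lambda>x. g x - c)"
proof -
  define A where "A = {dirichlet (\<lambda>x. g x - \<psi> x) | \<psi>. finite {x. \<psi> x \<noteq> 0}}"
  define I where "I = Inf A"
  have "bdd_below A"
    by (rule bdd_belowI[of _ 0]) (auto simp: A_def dirichlet_nonneg)
  then have I_le: "I \<le> dirichlet (\<lambda>x. g x - \<psi> x)" if "finite {x. \<psi> x \<noteq> 0}" for \<psi>
    unfolding I_def using that by (intro cInf_lower) (auto simp: A_def)
  have "A \<noteq> {}" by (auto simp: A_def intro!: exI[of _ "\<lambda>_. 0"])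
  have "\<exists>\<psi>. finite {x. \<psi> x \<noteq> 0} \<and> dirichlet (\<lambda>x. g x - \<psi> x) < I + inverse (real (Suc n))" for n
  proof -
    have "Inf A < I + inverse (real (Suc n))" by (simp add: I_def)
    then show ?thesis using cInf_lessD[OF \<open>A \<noteq> {}\<close>] unfolding A_def by blast
  qed
  then obtain \<psi> where \<psi>: "\<And>n. finite {x. \<psi> n x \<noteq> 0}"
    and near: "\<And>n. dirichlet (\<lambda>x. g x - \<psi> n x) < I + inverse (real (Suc n))"
    by metis
  define v where "v n x = max 0 (min (g x - \<psi> n x) N)" for n x
  have g\<psi>: "dirichlet_finite (\<lambda>x. g x - \<psi> n x)" for n
    by (rule dirichlet_diff(1)[OF g finite_support_dirichlet_finite[OF \<psi>]])
  have clip: "\<bar>v n x - v n y\<bar> \<le> \<bar>(g x - \<psi> n x) - (g y - \<psi> n y)\<bar>" for n x y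
    unfolding v_def by (simp add: max_def min_def)
  have v: "dirichlet_finite (v n)" for n
    by (rule dirichlet_contraction(1)[OF g\<psi>[of n] clip])
  have v_le: "dirichlet (v n) \<le> I + inverse (real (Suc n))" for n
    using dirichlet_contraction(2)[OF g\<psi>[of n] clip[of n]] near[of n] by linarith
  have v_range: "v n x \<in> {0..N}" for n x
    using range[of x] by (auto simp: v_def)
  have support: "finite {x. g x - v n x \<noteq> 0}" for n
    by (rule finite_subset[OF _ \<psi>[of n]]) (use range in \<open>auto simp: v_def\<close>)
  have minimal: "I \<le> dirichlet (\<lambda>x. v n x + \<phi> x)" if \<phi>: "finite {x. \<phi> x \<noteq> 0}" for n \<phi>
  proof -
    have "finite {x. g x - v n x - \<phi> x \<noteq> 0}"
      by (rule finite_subset[OF _ finite_UnI[OF support[of n] \<phi>]]) auto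
    from I_le[OF this] show ?thesis by (simp add: algebra_simps)
  qed
  have energy: "(\<lambda>n. dirichlet (v n)) \<longlonglongrightarrow> I"
  proof (rule tendsto_sandwich[OF _ _ tendsto_const])
    show "(\<lambda>n. I + inverse (real (Suc n))) \<longlonglongrightarrow> I"
      using tendsto_add[OF tendsto_const LIMSEQ_inverse_real_of_nat, of I] by simp
    show "\<forall>\<^sub>F n in sequentially. I \<le> dirichlet (v n)"
      using minimal[of "\<lambda>_. 0"] by simp
  qed (use v_le in auto)
  \<comment> \<open>The midpoint of two competitors is again a competitor.\<close>
  have cauchy: "dirichlet (\<lambda>x. v n x - v k x) \<le> 2 * dirichlet (v n) + 2 * dirichlet (v k) - 4 * I" for n k
  proof -
    have "finite {x. (v k x - v n x) / 2 \<noteq> 0}"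
      by (rule finite_subset[OF _ finite_UnI[OF support[of n] support[of k]]]) auto
    from minimal[OF this, of n] have "I \<le> dirichlet (\<lambda>x. (1 / 2) * (v n x + v k x))"
      by (simp add: field_simps)
    then have "4 * I \<le> dirichlet (\<lambda>x. v n x + v k x)"
      unfolding dirichlet_cmult by (simp add: power2_eq_square)
    then show ?thesis using parallelogram[OF v[of n] v[of k]] by simp
  qed
  obtain r l where r: "strict_mono r" and l: "\<And>x. (\<lambda>n. v (r n) x) \<longlonglongrightarrow> l x"
    using bounded_functions_subsequence[of v 0 N] v_range by blast
  have energy_r: "(\<lambda>n. dirichlet (v (r n))) \<longlonglongrightarrow> I"
    using LIMSEQ_subseq_LIMSEQ[OF energy r] by (simp add: o_def)
  have v_abs: "\<bar>v n x\<bar> \<le> N" for n x using v_range[of n x] by simp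
  have l_range: "l x \<in> {0..N}" for x
    using closed_sequentially[of "{0..N}" "\<lambda>n. v (r n) x" "l x"] l v_range by auto
  have "\<bar>l x\<bar> \<le> N" for x using l_range[of x] by simp
  moreover have "net_flow l z = 0" for z
  proof (rule minimizing_limit_flow_free)
    show "(\<lambda>n. net_flow (v (r n)) z) \<longlonglongrightarrow> net_flow l z"
      by (rule net_flow_tendsto[OF v_abs l])
  qed (use v minimal energy_r in auto)
  ultimately obtain c where c: "l = (\<lambda>_. c)" by (rule constant_if_flow_free)
  have defect: "dirichlet (\<lambda>x. v (r n) x - c) \<le> 2 * (dirichlet (v (r n)) - I)" for n
  proof (rule field_le_epsilon)
    fix \<epsilon> :: real assume "\<epsilon> > 0"
    then have "\<forall>\<^sub>F k in sequentially. dirichlet (v (r k)) < I + \<epsilon> / 2"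
      by (intro order_tendstoD(2)[OF energy_r]) simp
    then have "\<forall>\<^sub>F k in sequentially.
        dirichlet (\<lambda>x. v (r n) x - v (r k) x) \<le> 2 * (dirichlet (v (r n)) - I) + \<epsilon>"
    proof eventually_elim
      case (elim k)
      then show ?case using cauchy[of "r n" "r k"] by simp
    qed
    moreover have "(\<lambda>k. v (r n) x - v (r k) x) \<longlonglongrightarrow> v (r n) x - c" for x
      using l[of x] c by (intro tendsto_intros) simp
    ultimately show "dirichlet (\<lambda>x. v (r n) x - c) \<le> 2 * (dirichlet (v (r n)) - I) + \<epsilon>"
      using dirichlet_fatou(2)[of "\<lambda>k x. v (r n) x - v (r k) x" "\<lambda>x. v (r n) x - c"]
        dirichlet_diff(1)[OF v v] by blast
  qed
  have "(\<lambda>n. dirichlet (\<lambda>x. v (r n) x - c)) \<longlonglongrightarrow> 0"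
  proof (rule tendsto_sandwich[OF _ _ tendsto_const])
    show "(\<lambda>n. 2 * (dirichlet (v (r n)) - I)) \<longlonglongrightarrow> 0"
      using tendsto_mult_left[OF tendsto_diff[OF energy_r tendsto_const[of I]], of 2] by simp
  qed (use defect in \<open>auto simp: dirichlet_nonneg\<close>)
  moreover have "(\<lambda>n. g x - v (r n) x) \<longlonglongrightarrow> g x - c" for x
    using l[of x] c by (intro tendsto_intros) simp
  moreover have "dirichlet_finite (\<lambda>x. g x - c)"
    by (rule dirichlet_diff(1)[OF g dirichlet_const(1)])
  ultimately have "finitely_approximable (\<lambda>x. g x - c)"
    unfolding finitely_approximable_def using support
    by (intro conjI exI[of _ "\<lambda>n x. g x - v (r n) x"]) auto
  moreover have "c \<in> {0..N}" using l_range c by simp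
  ultimately show ?thesis by (rule that[rotated])
qed

text \<open>The functions \<open>w n\<close> tend to \<open>c\<close> pointwise and their energies tend to zero, so the
  difference of the positive part across an edge is controlled by \<open>t * dirichlet f\<close> for every
  \<open>t > 0\<close>, that is, it vanishes.\<close>

lemma truncation_constant:
  assumes f: "dirichlet_finite f" and subharmonic: "\<And>x. net_flow f x \<le> 0"
    and w: "\<And>n. dirichlet_finite (w n)" "(\<lambda>n. dirichlet (w n)) \<longlonglongrightarrow> 0"
      "\<And>x. (\<lambda>n. w n x) \<longlonglongrightarrow> c"
    and approx: "\<And>n. finitely_approximable (\<lambda>x. min (f x) N - w n x)"
  shows "max 0 (min (f x) N - c) = max 0 (min (f y) N - c)"
proof (rule constant_if_constant_along_edges[of "\<lambda>x. max 0 (min (f x) N - c)"])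
  fix x y assume edge: "0 < \<mu> x y"
  let ?lhs = "\<mu> x y * (max 0 (min (f x) N - c) - max 0 (min (f y) N - c))\<^sup>2"
  have "?lhs \<le> t * dirichlet f" if t: "0 < t" for t
  proof (rule LIMSEQ_le)
    show "(\<lambda>n. \<mu> x y * (max 0 (min (f x) N - w n x) - max 0 (min (f y) N - w n y))\<^sup>2) \<longlonglongrightarrow> ?lhs"
      by (intro tendsto_intros w)
    have "(\<lambda>n. t * dirichlet f + (1 + 1 / t) * (2 * dirichlet (w n)))
        \<longlonglongrightarrow> t * dirichlet f + (1 + 1 / t) * (2 * 0)"
      by (intro tendsto_intros w)
    then show "(\<lambda>n. t * dirichlet f + (1 + 1 / t) * (2 * dirichlet (w n))) \<longlonglongrightarrow> t * dirichlet f"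
      by simp
  qed (use truncation_edge_bound[OF f subharmonic w(1) approx t] in auto)
  then have "?lhs \<le> inverse (real (Suc n)) * dirichlet f" for n by simp
  moreover have "(\<lambda>n. inverse (real (Suc n)) * dirichlet f) \<longlonglongrightarrow> 0 * dirichlet f"
    by (intro tendsto_intros LIMSEQ_inverse_real_of_nat)
  ultimately have "?lhs \<le> 0 * dirichlet f" by (intro LIMSEQ_le_const) auto
  then show "max 0 (min (f x) N - c) = max 0 (min (f y) N - c)"
    using edge by (simp add: mult_le_0_iff)
qed

text \<open>Assume that \<open>f\<close> is unbounded and let \<open>N > f x0\<close>. Then \<open>min f N\<close> is approximable up to a constant
  \<open>c\<close>, and the positive part of \<open>min f N - c\<close> is constant. Comparing \<open>x0\<close> with a vertex where \<open>f\<close>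
  exceeds \<open>N\<close> gives \<open>c = N\<close>: thus \<open>min f N - N\<close> is approximable for all large \<open>N\<close>. Subtracting
  multiples of these functions for two levels \<open>N\<close> and \<open>M n\<close> cancels the constants and leaves
  \<open>min f N - w n\<close>, where \<open>w n = (N / M n) min f (M n)\<close> tends to zero pointwise and in energy.\<close>

lemma finite_energy_subharmonic_bounded:
  assumes f: "dirichlet_finite f" and nonneg: "\<And>x. 0 \<le> f x"
    and subharmonic: "\<And>x. net_flow f x \<le> 0"
  obtains B where "\<And>x. f x \<le> B"
proof (rule ccontr)
  assume "\<not> thesis"
  then have unbounded: "\<exists>x. B < f x" for B using that by (meson not_le)
  obtain x0 :: 'x where True by simp
  have trunc: "dirichlet_finite (\<lambda>x. min (f x) N)" "dirichlet (\<lambda>x. min (f x) N) \<le> dirichlet f" for N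
    by (rule dirichlet_contraction[OF f]; simp add: min_def)+
  have approx: "finitely_approximable (\<lambda>x. min (f x) N - N)" if N: "f x0 < N" for N
  proof -
    have "min (f x) N \<in> {0..N}" for x using nonneg[of x] nonneg[of x0] N by simp
    with trunc(1) obtain c where c: "c \<in> {0..N}" "finitely_approximable (\<lambda>x. min (f x) N - c)"
      by (rule approximable_up_to_constant)
    obtain x1 where "N < f x1" using unbounded by blast
    moreover have "max 0 (min (f x0) N - c) = max 0 (min (f x1) N - c)"
      by (rule truncation_constant[where w = "\<lambda>_ _. c"])
        (use f subharmonic c in \<open>auto simp: dirichlet_const\<close>)
    ultimately have "c = N" using N c(1) by (auto simp: max_def min_def split: if_splits)
    then show ?thesis using c(2) by simp
  qed
  define N where "N = f x0 + 1"
  define M where "M n = N * real (Suc n)" for n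
  define w where "w n x = inverse (real (Suc n)) * min (f x) (M n)" for n x
  have "0 < N" "f x0 < N" using nonneg[of x0] by (simp_all add: N_def)
  have "N \<le> M n" for n using \<open>0 < N\<close> by (simp add: M_def)
  have "max 0 (min (f x) N - 0) = max 0 (min (f y) N - 0)" for x y
  proof (rule truncation_constant[OF f subharmonic])
    show "dirichlet_finite (w n)" for n
      unfolding w_def by (rule dirichlet_finite_cmult[OF trunc(1)])
    show "(\<lambda>n. dirichlet (w n)) \<longlonglongrightarrow> 0"
    proof (rule tendsto_sandwich[OF _ _ tendsto_const])
      show "\<forall>\<^sub>F n in sequentially. dirichlet (w n) \<le> (inverse (real (Suc n)))\<^sup>2 * dirichlet f"
        unfolding w_def dirichlet_cmult using trunc(2) by (auto intro!: mult_left_mono)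
      have "(\<lambda>n. (inverse (real (Suc n)))\<^sup>2 * dirichlet f) \<longlonglongrightarrow> 0\<^sup>2 * dirichlet f"
        by (intro tendsto_intros LIMSEQ_inverse_real_of_nat)
      then show "(\<lambda>n. (inverse (real (Suc n)))\<^sup>2 * dirichlet f) \<longlonglongrightarrow> 0" by simp
    qed (simp add: dirichlet_nonneg)
    show "(\<lambda>n. w n x) \<longlonglongrightarrow> 0" for x
    proof (rule tendsto_sandwich[OF _ _ tendsto_const])
      show "\<forall>\<^sub>F n in sequentially. w n x \<le> inverse (real (Suc n)) * f x"
        unfolding w_def by (auto intro!: mult_left_mono)
      show "\<forall>\<^sub>F n in sequentially. 0 \<le> w n x"
        unfolding w_def using nonneg \<open>0 < N\<close> by (auto simp: M_def)
      show "(\<lambda>n. inverse (real (Suc n)) * f x) \<longlonglongrightarrow> 0"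
        using tendsto_mult_right[OF LIMSEQ_inverse_real_of_nat, of "f x"] by simp
    qed
    show "finitely_approximable (\<lambda>x. min (f x) N - w n x)" for n
    proof -
      have "f x0 < M n" using \<open>f x0 < N\<close> \<open>N \<le> M n\<close> by simp
      from finitely_approximable_diff[OF approx[OF \<open>f x0 < N\<close>]
          finitely_approximable_cmult[OF approx[OF this], of "inverse (real (Suc n))"]]
      have "finitely_approximable
        (\<lambda>x. min (f x) N - N - inverse (real (Suc n)) * (min (f x) (M n) - M n))" .
      moreover have "inverse (real (Suc n)) * M n = N" by (simp add: M_def)
      ultimately show ?thesis by (simp add: w_def right_diff_distrib)
    qed
  qed
  moreover obtain x1 where "N < f x1" using unbounded by blast
  ultimately show False
    using \<open>f x0 < N\<close> \<open>0 < N\<close> nonneg[of x0] by (metis diff_zero max.absorb2 min.absorb2 min.absorb1 less_imp_le less_irrefl)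
qed

section \<open>Bounded subharmonic functions and the random walk\<close>

definition average :: "('x \<Rightarrow> real) \<Rightarrow> 'x \<Rightarrow> real" where
  "average f x = (\<Sum>\<^sub>\<infinity>y. transition_prob \<mu> x y * f y)"

lemma transition_prob_nonneg: "0 \<le> transition_prob \<mu> x y"
  using edge_weight_nonneg no_isolated_vertex[of x] by (simp add: transition_prob_def)

lemma transition_prob_has_sum: "((\<lambda>y. transition_prob \<mu> x y) has_sum 1) UNIV"
  using has_sum_cmult_left[OF has_sum_infsum[OF edge_weight_summable[of x]],
      of "inverse (\<Sum>\<^sub>\<infinity>z. \<mu> x z)"] no_isolated_vertex[of x]
  by (simp add: transition_prob_def divide_inverse)

lemma average_summable:
  assumes "\<And>x. \<bar>f x\<bar> \<le> B"
  shows "(\<lambda>y. transition_prob \<mu> x y * f y) summable_on UNIV"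
proof (rule summable_on_abs_bound)
  show "(\<lambda>y. transition_prob \<mu> x y * B) summable_on UNIV"
    using transition_prob_has_sum by (intro summable_on_cmult_left has_sum_imp_summable)
qed (use assms in \<open>auto simp: abs_mult transition_prob_nonneg intro!: mult_left_mono\<close>)

lemma average_const: "average (\<lambda>_. c) x = c"
  using has_sum_cmult_left[OF transition_prob_has_sum, of x c]
  by (simp add: average_def infsumI)

lemma average_mono:
  assumes "\<And>x. \<bar>f x\<bar> \<le> B" "\<And>x. \<bar>g x\<bar> \<le> B'" "\<And>x. f x \<le> g x"
  shows "average f x \<le> average g x"
  unfolding average_def
  by (intro infsum_mono average_summable mult_left_mono)
    (use assms in \<open>auto simp: transition_prob_nonneg intro: average_summable\<close>)

lemma average_bounded:
  assumes "\<And>x. \<bar>f x\<bar> \<le> B"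
  shows "\<bar>average f x\<bar> \<le> B"
proof -
  have "f y \<le> B" "- B \<le> f y" "\<bar>B\<bar> \<le> B" "\<bar>- B\<bar> \<le> B" for y
    using assms[of y] by auto
  then have "average f x \<le> average (\<lambda>_. B) x" "average (\<lambda>_. - B) x \<le> average f x"
    using assms by (intro average_mono[of _ B _ B]; simp)+
  then show ?thesis by (simp add: average_const)
qed

lemma average_sum:
  assumes "finite I" "\<And>i x. i \<in> I \<Longrightarrow> \<bar>f i x\<bar> \<le> B"
  shows "average (\<lambda>x. \<Sum>i\<in>I. f i x) x = (\<Sum>i\<in>I. average (f i) x)"
proof -
  have "((\<lambda>y. \<Sum>i\<in>I. transition_prob \<mu> x y * f i y) has_sum (\<Sum>i\<in>I. average (f i) x)) UNIV"
    using assms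
  proof induction
    case (insert i I)
    then show ?case
      unfolding average_def
      by (auto intro!: has_sum_add has_sum_infsum average_summable[of "f i" B])
  qed simp
  then show ?thesis
    by (simp add: average_def sum_distrib_left infsumI)
qed

lemma net_flow_average:
  assumes "(\<lambda>y. transition_prob \<mu> x y * f y) summable_on UNIV"
  shows "net_flow f x = (\<Sum>\<^sub>\<infinity>y. \<mu> x y) * (f x - average f x)"
proof -
  let ?d = "\<Sum>\<^sub>\<infinity>y. \<mu> x y"
  have "((\<lambda>y. ?d * (transition_prob \<mu> x y * f x + (- 1) * (transition_prob \<mu> x y * f y)))
      has_sum ?d * (1 * f x + (- 1) * average f x)) UNIV"
    unfolding average_def
    by (intro has_sum_cmult_right has_sum_add has_sum_cmult_left transition_prob_has_sum
        has_sum_infsum assms)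
  moreover have "?d * (transition_prob \<mu> x y * f x + (- 1) * (transition_prob \<mu> x y * f y))
      = \<mu> x y * (f x - f y)" for y
    using no_isolated_vertex[of x] by (simp add: transition_prob_def field_simps)
  ultimately show ?thesis
    unfolding net_flow_def by (simp add: infsumI)
qed

text \<open>The iterated averages increase and are bounded; by dominated convergence their limit is fixed by
  averaging, so the Liouville property makes it a constant. This constant lies above \<open>f\<close> and below
  every upper bound of \<open>f\<close>.\<close>

lemma iterated_average_tendsto_Sup:
  assumes bound: "\<And>x. \<bar>f x\<bar> \<le> B" and subharmonic: "\<And>x. f x \<le> average f x"
  shows "(\<lambda>n. (average ^^ n) f x) \<longlonglongrightarrow> (SUP y. f y)"
proof -
  define h where "h n = (average ^^ n) f" for n
  have h_Suc: "h (Suc n) = average (h n)" for n by (simp add: h_def)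
  have h_bound: "\<bar>h n y\<bar> \<le> B" for n y
    by (induction n arbitrary: y) (auto simp: h_def bound intro: average_bounded)
  have h_step: "h n y \<le> h (Suc n) y" for n y
  proof (induction n arbitrary: y)
    case 0
    show ?case using subharmonic by (simp add: h_def)
  next
    case (Suc n)
    have "average (h n) y \<le> average (h (Suc n)) y"
      by (rule average_mono[OF h_bound h_bound Suc])
    then show ?case by (simp only: h_Suc)
  qed
  have f_le: "f y \<le> (SUP y. f y)" for y
    using bound by (intro cSUP_upper bdd_aboveI2[of _ _ B]) (auto simp: abs_le_iff)
  have h_le: "h n y \<le> (SUP y. f y)" for n y
  proof (induction n arbitrary: y)
    case 0
    show ?case using f_le by (simp add: h_def)
  next
    case (Suc n)
    have "average (h n) y \<le> average (\<lambda>_. SUP y. f y) y"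
      by (rule average_mono[OF h_bound order_refl Suc])
    then show ?case by (simp add: h_Suc average_const)
  qed
  have "\<exists>l. (\<lambda>n. h n y) \<longlonglongrightarrow> l" for y
    using incseq_convergent[of "\<lambda>n. h n y" "SUP y. f y"] h_step h_le
    by (metis incseq_SucI)
  then obtain l where l: "\<And>y. (\<lambda>n. h n y) \<longlonglongrightarrow> l y" by metis
  have l_bound: "\<bar>l y\<bar> \<le> B" for y
    by (rule LIMSEQ_le_const2[OF tendsto_rabs[OF l]]) (use h_bound in auto)
  have "average l y = l y" for y
  proof (rule LIMSEQ_unique)
    show "(\<lambda>n. h (Suc n) y) \<longlonglongrightarrow> l y" by (rule LIMSEQ_Suc[OF l])
    show "(\<lambda>n. h (Suc n) y) \<longlonglongrightarrow> average l y"
      unfolding h_Suc average_def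
    proof (rule infsum_dominated_convergence)
      show "(\<lambda>z. transition_prob \<mu> y z * B) summable_on UNIV"
        using h_bound by (intro average_summable[of "\<lambda>_. B" "\<bar>B\<bar>"]) simp
      show "\<bar>transition_prob \<mu> y z * h n z\<bar> \<le> transition_prob \<mu> y z * B" for n z
        using h_bound by (auto simp: abs_mult transition_prob_nonneg intro!: mult_left_mono)
    qed (intro tendsto_intros l)
  qed
  then have "net_flow l y = 0" for y
    using net_flow_average[OF average_summable[OF l_bound]] by simp
  with l_bound obtain c where c: "l = (\<lambda>_. c)" by (rule constant_if_flow_free)
  have "f y \<le> c" for y
  proof (rule LIMSEQ_le_const)
    show "(\<lambda>n. h n y) \<longlonglongrightarrow> c" using l[of y] c by simp
    have "f y \<le> h n y" for n
      by (induction n) (use h_step in \<open>auto simp: h_def intro: order_trans\<close>)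
    then show "\<exists>n0. \<forall>n\<ge>n0. f y \<le> h n y" by blast
  qed
  then have "(SUP y. f y) \<le> c" by (intro cSUP_least) auto
  moreover have "c \<le> (SUP y. f y)"
    by (rule LIMSEQ_le_const2[of "\<lambda>n. h n x"]) (use l[of x] c h_le in auto)
  ultimately have "c = (SUP y. f y)" by simp
  then show ?thesis using l[of x] c by (simp add: h_def)
qed

text \<open>The sum \<open>g\<close> of the functions is subharmonic too. Averaging is linear, so comparing the limits of the
  iterated averages shows that the supremum of \<open>g\<close> is the sum of the suprema. A vertex where \<open>g\<close> is within
  \<open>e\<close> of its supremum works for each summand, since all defects are nonnegative.\<close>

lemma subharmonic_simultaneously_near_Sup:
  assumes I: "finite I" and bound: "\<And>i x. i \<in> I \<Longrightarrow> \<bar>f i x\<bar> \<le> B"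
    and subharmonic: "\<And>i x. i \<in> I \<Longrightarrow> f i x \<le> average (f i) x" and e: "0 < e"
  shows "\<exists>x. \<forall>i\<in>I. (SUP y. f i y) - e < f i x"
proof -
  define g where "g x = (\<Sum>i\<in>I. f i x)" for x
  have f_le: "f i x \<le> (SUP y. f i y)" if "i \<in> I" for i x
    using bound[OF that] by (intro cSUP_upper bdd_aboveI2[of _ _ B]) (auto simp: abs_le_iff)
  have g_bound: "\<bar>g x\<bar> \<le> (\<Sum>i\<in>I. B)" for x
    unfolding g_def using bound by (intro order_trans[OF sum_abs] sum_mono)
  have g_subharmonic: "g x \<le> average g x" for x
  proof -
    have "average g x = (\<Sum>i\<in>I. average (f i) x)"
      unfolding g_def by (rule average_sum[OF I bound])
    then show ?thesis unfolding g_def using subharmonic by (simp add: sum_mono)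
  qed
  have iter_bound: "\<bar>(average ^^ n) (f i) x\<bar> \<le> B" if "i \<in> I" for i n x
    using bound[OF that] by (induction n arbitrary: x) (auto intro: average_bounded)
  have "(average ^^ n) g x = (\<Sum>i\<in>I. (average ^^ n) (f i) x)" for n x
  proof (induction n arbitrary: x)
    case 0
    show ?case by (simp add: g_def)
  next
    case (Suc n)
    then have "(average ^^ n) g = (\<lambda>x. \<Sum>i\<in>I. (average ^^ n) (f i) x)" by blast
    then show ?case using average_sum[of I "\<lambda>i. (average ^^ n) (f i)" B, OF I iter_bound] by simp
  qed
  moreover obtain x :: 'x where True by simp
  moreover have "(\<lambda>n. \<Sum>i\<in>I. (average ^^ n) (f i) x) \<longlonglongrightarrow> (\<Sum>i\<in>I. SUP y. f i y)"
    by (intro tendsto_sum iterated_average_tendsto_Sup[OF bound subharmonic])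
  ultimately have "(\<Sum>i\<in>I. SUP y. f i y) = (SUP y. g y)"
    using LIMSEQ_unique iterated_average_tendsto_Sup[OF g_bound g_subharmonic, of x] by auto
  then have "(\<Sum>i\<in>I. SUP y. f i y) - e < (SUP y. g y)" using e by simp
  then obtain x where x: "(\<Sum>i\<in>I. SUP y. f i y) - e < g x"
    using less_cSUP_iff[OF UNIV_not_empty, of g] bdd_aboveI2[of UNIV g] g_bound
    by (metis (no_types, lifting) UNIV_I abs_le_iff)
  have "(SUP y. f i y) - e < f i x" if "i \<in> I" for i
  proof -
    have "(SUP y. f i y) - f i x \<le> (\<Sum>j\<in>I. (SUP y. f j y) - f j x)"
      using I that f_le by (intro member_le_sum) auto
    then show ?thesis using x by (simp add: g_def sum_subtractf)
  qed
  then show ?thesis by blast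
qed

text \<open>Apply the preceding lemma to the distances from the points of a finite \<open>e\<close>-net \<open>D\<close>. The point \<open>p\<close> of
  the net next to \<open>u x\<close> satisfies \<open>(SUP y. dist (u y) p) < dist (u x) p + e < 2 * e\<close>.\<close>

lemma constant_if_distances_subharmonic:
  fixes u :: "'x \<Rightarrow> 'y::metric_space"
  assumes subharmonic: "\<And>x p. dist (u x) p \<le> average (\<lambda>y. dist (u y) p) x"
    and K: "compact K" "range u \<subseteq> K"
  shows "u constant_on UNIV"
proof -
  have small: "dist (u a) (u b) \<le> 4 * e" if e: "0 < e" for a b e
  proof -
    obtain D where D: "finite D" "D \<subseteq> K" "K \<subseteq> (\<Union>p\<in>D. ball p e)"
      using K(1) e by (metis seq_compact_imp_totally_bounded compact_imp_seq_compact)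
    obtain B where B: "dist p q \<le> B" if "p \<in> K" "q \<in> K" for p q
      using compact_imp_bounded[OF K(1)] unfolding bounded_two_points by blast
    have bound: "\<bar>dist (u x) p\<bar> \<le> B" if "p \<in> D" for p x
    proof -
      have "u x \<in> K" "p \<in> K" using D(2) K(2) that by auto
      then show ?thesis using B by simp
    qed
    obtain x where x: "\<And>p. p \<in> D \<Longrightarrow> (SUP y. dist (u y) p) - e < dist (u x) p"
      using subharmonic_simultaneously_near_Sup[of D "\<lambda>p x. dist (u x) p" B e, OF D(1) bound subharmonic e] by blast
    obtain p where p: "p \<in> D" "dist p (u x) < e"
      using D(3) K(2) by fastforce
    have "dist (u y) p \<le> 2 * e" for y
    proof -
      have "dist (u y) p \<le> (SUP y. dist (u y) p)"
        using bound[OF p(1)] by (intro cSUP_upper bdd_aboveI2[of _ _ B]) auto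
      then show ?thesis using x[OF p(1)] p(2) by (simp add: dist_commute)
    qed
    from this[of a] this[of b] show ?thesis
      using dist_triangle2[of "u a" "u b" p] by simp
  qed
  have "dist (u a) (u b) \<le> 0" for a b
  proof (rule field_le_epsilon)
    fix e :: real assume "0 < e"
    then show "dist (u a) (u b) \<le> 0 + e" using small[of "e / 4" a b] by simp
  qed
  then show ?thesis by (auto simp: constant_on_def)
qed

end

section \<open>Harmonic maps into Hadamard spaces\<close>

text \<open>At an isolated vertex the transition measure is zero and cannot push forward to a
  probability measure.\<close>

lemma (in weighted_graph) degree_pos_if_harmonic_map:
  assumes "harmonic_map \<mu> u"
  shows "0 < (\<Sum>\<^sub>\<infinity>y. \<mu> x y)"
proof (rule ccontr)
  assume "\<not> ?thesis"
  moreover have "0 \<le> (\<Sum>\<^sub>\<infinity>y. \<mu> x y)"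
    by (intro infsum_nonneg edge_weight_nonneg)
  ultimately have zero: "transition_prob \<mu> x = (\<lambda>_. 0)"
    by (simp add: transition_prob_def fun_eq_iff)
  have "prob_space (distr (transition_measure \<mu> x) borel u)"
    using assms by (auto simp: harmonic_map_def is_barycenter_def prob_first_moment_def)
  then have "emeasure (distr (transition_measure \<mu> x) borel u) UNIV = 1"
    using prob_space.emeasure_space_1 by fastforce
  moreover have "u \<in> transition_measure \<mu> x \<rightarrow>\<^sub>M borel"
    by (simp add: transition_measure_def measurable_def space_point_measure sets_point_measure)
  then have "emeasure (distr (transition_measure \<mu> x) borel u) UNIV = emeasure (transition_measure \<mu> x) UNIV"
    by (subst emeasure_distr) (auto simp: transition_measure_def space_point_measure)
  moreover have "emeasure (transition_measure \<mu> x) UNIV = 0"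
    by (simp add: transition_measure_def point_measure_def zero emeasure_density)
  ultimately show False by simp
qed

lemma (in liouville_graph) harmonic_map_distance_subharmonic:
  fixes u :: "'x \<Rightarrow> 'y::hadamard_space"
  assumes u: "harmonic_map \<mu> u"
  shows "(\<lambda>y. transition_prob \<mu> x y * dist (u y) p) summable_on UNIV"
    "dist (u x) p \<le> average (\<lambda>y. dist (u y) p) x"
proof -
  show sum: "(\<lambda>y. transition_prob \<mu> x y * dist (u y) p) summable_on UNIV"
    using u by (simp add: harmonic_map_def map_domain_def mult.commute)
  have u_meas: "u \<in> transition_measure \<mu> x \<rightarrow>\<^sub>M borel"
    by (simp add: transition_measure_def measurable_def space_point_measure sets_point_measure)
  have "is_barycenter (distr (transition_measure \<mu> x) borel u) (u x)"
    using u by (simp add: harmonic_map_def)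
  then have "dist (u x) p \<le> (\<integral>q. dist p q \<partial>distr (transition_measure \<mu> x) borel u)"
    by (rule barycenter_dist_le_mean)
  also have "\<dots> = (\<integral>y. dist p (u y) \<partial>transition_measure \<mu> x)"
    by (rule integral_distr[OF u_meas])
      (intro borel_measurable_continuous_onI continuous_intros)
  also have "\<dots> = (\<integral>y. transition_prob \<mu> x y * dist (u y) p \<partial>count_space UNIV)"
    unfolding transition_measure_def point_measure_def
    by (subst integral_density) (auto simp: transition_prob_nonneg dist_commute)
  also have "\<dots> = average (\<lambda>y. dist (u y) p) x"
  proof -
    let ?f = "\<lambda>y. transition_prob \<mu> x y * dist (u y) p"
    have "Infinite_Set_Sum.abs_summable_on ?f UNIV"
      using sum summable_on_iff_abs_summable_on_real[of ?f UNIV] abs_summable_equivalent[of ?f UNIV]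
      by blast
    from infsetsum_infsum[OF this] show ?thesis
      by (simp add: average_def infsetsum_def)
  qed
  finally show "dist (u x) p \<le> average (\<lambda>y. dist (u y) p) x" .
qed

text \<open>The distance to \<open>p\<close> is 1-Lipschitz.\<close>

lemma (in weighted_graph) finite_energy_distance_dirichlet_finite:
  fixes u :: "'x \<Rightarrow> 'y::metric_space"
  assumes "energy \<mu> u < \<infinity>"
  shows "dirichlet_finite (\<lambda>x. dist (u x) p)"
proof -
  define s where "s = (\<lambda>(x, y). \<mu> x y * (dist (u x) (u y))\<^sup>2)"
  define S where "S = (\<Sum>\<^sub>\<infinity>e. ennreal (s e))"
  have s_nonneg: "0 \<le> s e" for e
    by (auto simp: s_def edge_weight_nonneg split: prod.split)
  have "energy \<mu> u = 1 / 2 * S"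
    by (simp add: energy_def S_def s_def case_prod_unfold)
  then have "S \<noteq> \<infinity>"
    using assms by (auto simp: ennreal_mult_top)
  have part: "sum s F \<le> enn2real S" if "finite F" for F
  proof -
    have "(\<Sum>e\<in>F. ennreal (s e)) = (\<Sum>\<^sub>\<infinity>e\<in>F. ennreal (s e))" using that by simp
    also have "\<dots> \<le> S"
      unfolding S_def by (rule infsum_mono_neutral) (auto intro: nonneg_summable_on_complete)
    finally have "ennreal (sum s F) \<le> S" using s_nonneg by (simp add: sum_ennreal)
    then show ?thesis
      using \<open>S \<noteq> \<infinity>\<close> s_nonneg
      by (metis enn2real_ennreal enn2real_mono infinity_ennreal_def sum_nonneg top.not_eq_extremum)
  qed
  have "s summable_on UNIV"
    using part s_nonneg by (intro nonneg_bdd_above_summable_on bdd_aboveI2[where M = "enn2real S"]) auto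
  then show ?thesis
    unfolding dirichlet_finite_def
  proof (rule summable_on_abs_bound)
    fix e
    have "\<bar>dist (u (fst e)) p - dist (u (snd e)) p\<bar> \<le> dist (u (fst e)) (u (snd e))"
      using abs_dist_diff_le[of "u (fst e)" p "u (snd e)"] by (simp add: dist_commute)
    then have "(gradient (\<lambda>x. dist (u x) p) e)\<^sup>2 \<le> (dist (u (fst e)) (u (snd e)))\<^sup>2"
      by (simp add: gradient_def abs_le_square_iff[symmetric])
    then show "\<bar>pair_weight e * (gradient (\<lambda>x. dist (u x) p) e)\<^sup>2\<bar> \<le> s e"
      using pair_weight_nonneg[of e]
      by (simp add: s_def case_prod_unfold abs_mult pair_weight_def mult_left_mono)
  qed
qed

theorem theorem1p13:
  fixes m :: "'x::countable \<Rightarrow> real"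
    and \<mu> :: "'x \<Rightarrow> 'x \<Rightarrow> real"
    and u :: "'x \<Rightarrow> 'y::hadamard_space"
  assumes graph: "weighted_graph m \<mu>"
    and connected: "connected_graph \<mu>"
    and liouville: "\<And>f. harmonic_function m \<mu> f \<Longrightarrow> bounded (range f) \<Longrightarrow> f constant_on UNIV"
    and locally_compact: "locally_compact_space (euclidean :: 'y topology)"
    and harmonic: "harmonic_map \<mu> u"
    and finite_energy: "energy \<mu> u < \<infinity>"
  shows "u constant_on UNIV"
proof -
  interpret weighted_graph m \<mu> by (rule graph)
  interpret liouville_graph m \<mu>
    by unfold_locales (use connected liouville degree_pos_if_harmonic_map[OF harmonic] in auto)
  note subharmonic = harmonic_map_distance_subharmonic[OF harmonic]
  fix p :: 'y
  have "dirichlet_finite (\<lambda>x. dist (u x) p)"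
    by (rule finite_energy_distance_dirichlet_finite[OF finite_energy])
  moreover have "net_flow (\<lambda>x. dist (u x) p) x \<le> 0" for x
    using net_flow_average[OF subharmonic(1)[where p = p], of x] subharmonic(2)[where x = x and p = p] no_isolated_vertex[of x]
    by (simp add: mult_le_0_iff)
  ultimately obtain B where "\<And>x. dist (u x) p \<le> B"
    using finite_energy_subharmonic_bounded[of "\<lambda>x. dist (u x) p"] by auto
  then have "range u \<subseteq> cball p B"
    by (auto simp: dist_commute)
  then show ?thesis
    by (rule constant_if_distances_subharmonic[OF subharmonic(2)
        compact_cball_locally_compact_hadamard[OF locally_compact]])
qed

end
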